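(* Let $p$ be an odd prime, let $H$ be one of the groups $H_1, H_2$, and let $\mathcal{A}$ be a non-commutative $p$-S-ring over $H$ such that, with $L := \mathbf{O}^{\theta}(\mathcal{A})$, (A) $|T| = p$ for each $T \in \mathrm{Bsets}(\mathcal{A}) \setminus \mathrm{Bsets}(\mathcal{A}_L)$, and (B) $|\{ \mathrm{St}_R(T) \mid T \in \mathrm{Bsets}(\mathcal{A}) \setminus \mathrm{Bsets}(\mathcal{A}_L) \}| = p-1$. Let $z$ be a nontrivial element of the center $Z(H)$. Let $T_1, \dots, T_{p-1}$ be elements of $\mathrm{Bsets}(\mathcal{A}) \setminus \mathrm{Bsets}(\mathcal{A}_L)$ such that $\mathrm{St}_R(T_i) \neq \mathrm{St}_R(T_j)$ for distinct $1 \le i, j \le p-1$. Then $$\mathrm{Bsets}(\mathcal{A}) = \{\{l\} \mid l \in L\} \cup \bigcup_{1 \le i \le p-1} \{T_i z^j \mid 0 \le j \le p-1\}.$$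
   Context: Groups: $H_1 = \langle a, b \mid a^{p^2} = b^p = 1,\ ab = ba^{p+1} \rangle$ and $H_2 = \langle a, b, c \mid a^p = b^p = c^p = 1,\ [a,b]=c,\ [a,c]=[b,c]=1 \rangle$ (the two non-abelian groups of order $p^3$ up to isomorphism). For a finite group $H$ and nonempty $T \subseteq H$, put $\underline{T} := \sum_{t \in T} t \in \mathbb{Q}H$. A subalgebra $\mathcal{A}$ of $\mathbb{Q}H$ is an S-ring (Schur ring) over $H$ if there is a partition $\mathrm{Bsets}(\mathcal{A}) = \{T_0, \dots, T_r\}$ of $H$ with $T_0 = \{1_H\}$, with $T_i^{-1} := \{t^{-1} \mid t \in T_i\} \in \mathrm{Bsets}(\mathcal{A})$ for all $i$, and with $\{\underline{T_i}\}$ a linear basis of $\mathcal{A}$. An S-ring over a $p$-group is a $p$-S-ring if every element of $\mathrm{Bsets}(\mathcal{A})$ has size a power of $p$. $\mathbf{O}^{\theta}(\mathcal{A})$ is the subgroup of $H$ generated by all sets $T^{-1}T$, $T \in \mathrm{Bsets}(\mathcal{A})$; $\mathrm{Bsets}(\mathcal{A}_L) = \{T \in \mathrm{Bsets}(\mathcal{A}) \mid T \subseteq L\}$; $\mathrm{St}_R(T) = \{h \in H \mid Th = T\}$. Under the standing assumptions it is known that $L = \{h \in H \mid \{h\} \in \mathrm{Bsets}(\mathcal{A})\} \cong C_p \times C_p$. *)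

theory Defs
  imports
    "HOL-Algebra.Generated_Groups"
    "HOL-Computational_Algebra.Primes"
    "HOL-Library.Disjoint_Sets"
    "HOL-Library.Function_Algebras"
    "HOL-Library.Indicator_Function"
begin

section \<open>Groups given by a presentation\<close>

text \<open>
  A letter is a generator together with an exponent sign (True for the generator itself, False for
  its inverse).  All elements of the type of generators are generators, and a relation is a pair of
  words that become equal.
\<close>

type_synonym 'g word = "('g \<times> bool) list"

inductive pres_eq :: "('g word \<times> 'g word) set \<Rightarrow> 'g word \<Rightarrow> 'g word \<Rightarrow> bool"
  for R :: "('g word \<times> 'g word) set"
  where
    pres_refl: "pres_eq R u u"
  | pres_sym: "pres_eq R u v \<Longrightarrow> pres_eq R v u"
  | pres_trans: "pres_eq R u v \<Longrightarrow> pres_eq R v w \<Longrightarrow> pres_eq R u w"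
  | pres_cancel: "pres_eq R (u @ [(g, e), (g, \<not> e)] @ v) (u @ v)"
  | pres_rel: "(r, s) \<in> R \<Longrightarrow> pres_eq R (u @ r @ v) (u @ s @ v)"

definition pres_class :: "('g word \<times> 'g word) set \<Rightarrow> 'g word \<Rightarrow> 'g word set"
  where "pres_class R u = {v. pres_eq R u v}"

definition presented_group :: "('g word \<times> 'g word) set \<Rightarrow> 'g word set monoid"
  where "presented_group R =
    \<lparr>carrier = range (pres_class R),
     monoid.mult = (\<lambda>X Y. \<Union>u\<in>X. \<Union>v\<in>Y. pres_class R (u @ v)),
     one = pres_class R []\<rparr>"

lemma pres_class_eq_iff: "pres_class R u = pres_class R v \<longleftrightarrow> pres_eq R u v"
  unfolding pres_class_def by (auto intro: pres_refl pres_sym pres_trans)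

lemma pres_eq_context: "pres_eq R u v \<Longrightarrow> pres_eq R (x @ u @ y) (x @ v @ y)"
proof (induction rule: pres_eq.induct)
  case (pres_cancel u g e v)
  show ?case using pres_eq.pres_cancel[of R "x @ u" g e "v @ y"] by simp
next
  case (pres_rel r s u v)
  then show ?case using pres_eq.pres_rel[of r s R "x @ u" "v @ y"] by simp
next
  case (pres_trans u v w)
  then show ?case by (metis pres_eq.pres_trans)
qed (simp_all add: pres_refl pres_sym)

lemma pres_eq_append: "pres_eq R u u' \<Longrightarrow> pres_eq R v v' \<Longrightarrow> pres_eq R (u @ v) (u' @ v')"
  using pres_eq_context[of R u u' "[]" v] pres_eq_context[of R v v' u' "[]"]
  by (auto intro: pres_trans)

lemma presented_group_mult:
  "pres_class R u \<otimes>\<^bsub>presented_group R\<^esub> pres_class R v = pres_class R (u @ v)"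
proof -
  have eq: "pres_class R (u' @ v') = pres_class R (u @ v)"
    if "u' \<in> pres_class R u" "v' \<in> pres_class R v" for u' v'
  proof -
    have "pres_eq R u u'" "pres_eq R v v'"
      using that by (simp_all add: pres_class_def)
    then show ?thesis
      unfolding pres_class_eq_iff by (intro pres_sym[OF pres_eq_append])
  qed
  have ne: "pres_class R w \<noteq> {}" for w :: "'a word"
    using pres_refl by (auto simp: pres_class_def)
  have "(\<Union>u'\<in>pres_class R u. \<Union>v'\<in>pres_class R v. pres_class R (u' @ v')) =
      (\<Union>u'\<in>pres_class R u. \<Union>v'\<in>pres_class R v. pres_class R (u @ v))"
    by (intro SUP_cong refl eq)
  also have "\<dots> = pres_class R (u @ v)"
    by (simp add: ne)
  finally show ?thesis
    by (simp add: presented_group_def)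
qed

lemma pres_eq_inverse: "pres_eq R (rev (map (\<lambda>(g, e). (g, \<not> e)) u) @ u) []"
proof (induction u)
  case Nil
  show ?case by (simp add: pres_refl)
next
  case (Cons l u)
  obtain g e where l: "l = (g, e)" by (cases l)
  have "pres_eq R (rev (map (\<lambda>(g, e). (g, \<not> e)) u) @ [(g, \<not> e), (g, \<not> \<not> e)] @ u)
          (rev (map (\<lambda>(g, e). (g, \<not> e)) u) @ u)"
    by (rule pres_cancel)
  with Cons.IH show ?case by (auto simp: l intro: pres_trans)
qed

lemma group_presented_group: "group (presented_group R)"
proof (rule groupI)
  fix X Y assume "X \<in> carrier (presented_group R)" "Y \<in> carrier (presented_group R)"
  then obtain u v where "X = pres_class R u" "Y = pres_class R v"
    by (auto simp: presented_group_def)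
  then show "X \<otimes>\<^bsub>presented_group R\<^esub> Y \<in> carrier (presented_group R)"
    by (simp add: presented_group_mult) (simp add: presented_group_def)
next
  fix X Y Z
  assume "X \<in> carrier (presented_group R)" "Y \<in> carrier (presented_group R)"
    "Z \<in> carrier (presented_group R)"
  then obtain u v w where "X = pres_class R u" "Y = pres_class R v" "Z = pres_class R w"
    by (auto simp: presented_group_def)
  then show "X \<otimes>\<^bsub>presented_group R\<^esub> Y \<otimes>\<^bsub>presented_group R\<^esub> Z =
      X \<otimes>\<^bsub>presented_group R\<^esub> (Y \<otimes>\<^bsub>presented_group R\<^esub> Z)"
    by (simp add: presented_group_mult)
next
  show "\<one>\<^bsub>presented_group R\<^esub> \<in> carrier (presented_group R)"
    by (simp add: presented_group_def)
next
  have one: "\<one>\<^bsub>presented_group R\<^esub> = pres_class R []"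
    by (simp add: presented_group_def)
  fix X assume "X \<in> carrier (presented_group R)"
  then obtain u where u: "X = pres_class R u"
    by (auto simp: presented_group_def)
  show "\<one>\<^bsub>presented_group R\<^esub> \<otimes>\<^bsub>presented_group R\<^esub> X = X"
    by (simp add: one u presented_group_mult)
  have "pres_class R (rev (map (\<lambda>(g, e). (g, \<not> e)) u)) \<otimes>\<^bsub>presented_group R\<^esub> X =
      \<one>\<^bsub>presented_group R\<^esub>"
    by (simp add: one u presented_group_mult pres_class_eq_iff pres_eq_inverse)
  moreover have "pres_class R (rev (map (\<lambda>(g, e). (g, \<not> e)) u)) \<in> carrier (presented_group R)"
    by (simp add: presented_group_def)
  ultimately show "\<exists>Y\<in>carrier (presented_group R).
      Y \<otimes>\<^bsub>presented_group R\<^esub> X = \<one>\<^bsub>presented_group R\<^esub>"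
    by blast
qed

datatype gens_ab = a1 | b1

definition H1 :: "nat \<Rightarrow> gens_ab word set monoid"
  where "H1 p =
    (let a = (a1, True); b = (b1, True) in
     presented_group
       {(replicate (p\<^sup>2) a, []),
        (replicate p b, []),
        ([a, b], [b] @ replicate (p + 1) a)})"

datatype gens_abc = a2 | b2 | c2

text \<open>The commutator convention is $[x,y] = x^{-1} y^{-1} x y$.\<close>

definition comm_word :: "'g \<Rightarrow> 'g \<Rightarrow> 'g word"
  where "comm_word x y = [(x, False), (y, False), (x, True), (y, True)]"

definition H2 :: "nat \<Rightarrow> gens_abc word set monoid"
  where "H2 p =
    presented_group
      {(replicate p (a2, True), []),
       (replicate p (b2, True), []),
       (replicate p (c2, True), []),
       (comm_word a2 b2, [(c2, True)]),
       (comm_word a2 c2, []),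
       (comm_word b2 c2, [])}"


section \<open>The rational group algebra\<close>

text \<open>
  An element of the group algebra of a finite group \<open>H\<close> is a rational-valued function that vanishes
  outside of \<open>carrier H\<close>.  Addition is that of \<^theory>\<open>HOL-Library.Function_Algebras\<close>; the
  pointwise product of that theory is not used.
\<close>

definition rat_scale :: "rat \<Rightarrow> ('a \<Rightarrow> rat) \<Rightarrow> 'a \<Rightarrow> rat"
  where "rat_scale c f = (\<lambda>x. c * f x)"

interpretation rat_fun: vector_space rat_scale
  by unfold_locales (auto simp: rat_scale_def fun_eq_iff algebra_simps)

definition group_algebra :: "('a, 'm) monoid_scheme \<Rightarrow> ('a \<Rightarrow> rat) set"
  where "group_algebra H = {f. \<forall>x. x \<notin> carrier H \<longrightarrow> f x = 0}"

definition conv :: "('a, 'm) monoid_scheme \<Rightarrow> ('a \<Rightarrow> rat) \<Rightarrow> ('a \<Rightarrow> rat) \<Rightarrow> 'a \<Rightarrow> rat"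
  where "conv H f g =
    (\<lambda>x. if x \<in> carrier H then \<Sum>y\<in>carrier H. f y * g (inv\<^bsub>H\<^esub> y \<otimes>\<^bsub>H\<^esub> x) else 0)"

text \<open>\<open>underline T\<close> is the sum of the elements of \<open>T\<close> in the group algebra.\<close>

definition underline :: "'a set \<Rightarrow> 'a \<Rightarrow> rat"
  where "underline T = indicator T"

definition group_subalgebra :: "('a, 'm) monoid_scheme \<Rightarrow> ('a \<Rightarrow> rat) set \<Rightarrow> bool"
  where "group_subalgebra H A \<longleftrightarrow>
    A \<subseteq> group_algebra H \<and>
    rat_fun.subspace A \<and>
    underline {\<one>\<^bsub>H\<^esub>} \<in> A \<and>
    (\<forall>f\<in>A. \<forall>g\<in>A. conv H f g \<in> A)"

definition noncommutative_algebra :: "('a, 'm) monoid_scheme \<Rightarrow> ('a \<Rightarrow> rat) set \<Rightarrow> bool"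
  where "noncommutative_algebra H A \<longleftrightarrow> (\<exists>f\<in>A. \<exists>g\<in>A. conv H f g \<noteq> conv H g f)"


section \<open>S-rings\<close>

definition basic_partition ::
    "('a, 'm) monoid_scheme \<Rightarrow> ('a \<Rightarrow> rat) set \<Rightarrow> 'a set set \<Rightarrow> bool"
  where "basic_partition H A P \<longleftrightarrow>
    partition_on (carrier H) P \<and>
    {\<one>\<^bsub>H\<^esub>} \<in> P \<and>
    (\<forall>T\<in>P. set_inv\<^bsub>H\<^esub> T \<in> P) \<and>
    rat_fun.independent (underline ` P) \<and>
    rat_fun.span (underline ` P) = A"

definition S_ring :: "('a, 'm) monoid_scheme \<Rightarrow> ('a \<Rightarrow> rat) set \<Rightarrow> bool"
  where "S_ring H A \<longleftrightarrow> group_subalgebra H A \<and> (\<exists>P. basic_partition H A P)"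

text \<open>The partition is determined by the algebra, see \<open>basic_partition_unique\<close> below.\<close>

definition Bsets :: "('a, 'm) monoid_scheme \<Rightarrow> ('a \<Rightarrow> rat) set \<Rightarrow> 'a set set"
  where "Bsets H A = (THE P. basic_partition H A P)"

lemma span_underline_const:
  assumes "partition_on X P" "f \<in> rat_fun.span (underline ` P)" "T \<in> P" "x \<in> T" "y \<in> T"
  shows "f x = f y"
  using assms(2)
proof (induction rule: rat_fun.span_induct_alt)
  case base
  show ?case by simp
next
  case (step c g h)
  then obtain S where S: "S \<in> P" "g = underline S" by auto
  have "x \<in> S \<longleftrightarrow> y \<in> S"
    using assms(1,3-5) S(1) unfolding partition_on_def disjoint_def by blast
  then show ?case
    using step by (simp add: S rat_scale_def underline_def indicator_def)
qed

lemma basic_partition_refines: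
  assumes P: "basic_partition H A P" and Q: "basic_partition H A Q" and T: "T \<in> P"
  shows "T \<in> Q"
proof -
  have part: "partition_on (carrier H) P" "partition_on (carrier H) Q"
    using P Q by (auto simp: basic_partition_def)
  have constQ: "x \<in> U \<longleftrightarrow> y \<in> U" if "U \<in> P" "S \<in> Q" "x \<in> S" "y \<in> S" for U S x y
  proof -
    have "underline U \<in> rat_fun.span (underline ` Q)"
      using P Q that(1) by (metis basic_partition_def imageI rat_fun.span_base)
    from span_underline_const[OF part(2) this that(2-4)] show ?thesis
      by (auto simp: underline_def indicator_def split: if_splits)
  qed
  have constP: "x \<in> U \<longleftrightarrow> y \<in> U" if "U \<in> Q" "S \<in> P" "x \<in> S" "y \<in> S" for U S x y
  proof -
    have "underline U \<in> rat_fun.span (underline ` P)"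
      using P Q that(1) by (metis basic_partition_def imageI rat_fun.span_base)
    from span_underline_const[OF part(1) this that(2-4)] show ?thesis
      by (auto simp: underline_def indicator_def split: if_splits)
  qed
  have "T \<noteq> {}" "T \<subseteq> carrier H"
    using part(1) T by (auto simp: partition_on_def)
  then obtain x where x: "x \<in> T" "x \<in> carrier H"
    by blast
  with part(2) obtain S where S: "S \<in> Q" "x \<in> S"
    unfolding partition_on_def by blast
  have "S = T"
  proof
    show "S \<subseteq> T"
      using constQ[OF T S(1) _ S(2)] x(1) by auto
    show "T \<subseteq> S"
      using constP[OF S(1) T _ x(1)] S(2) by auto
  qed
  with S show ?thesis by simp
qed

lemma basic_partition_unique:
  assumes "basic_partition H A P" "basic_partition H A Q"
  shows "P = Q"
  using basic_partition_refines[OF assms] basic_partition_refines[OF assms(2,1)] by auto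

lemma Bsets_eq: "basic_partition H A P \<Longrightarrow> Bsets H A = P"
  unfolding Bsets_def by (rule the_equality) (auto dest: basic_partition_unique)

definition p_S_ring :: "nat \<Rightarrow> ('a, 'm) monoid_scheme \<Rightarrow> ('a \<Rightarrow> rat) set \<Rightarrow> bool"
  where "p_S_ring p H A \<longleftrightarrow> S_ring H A \<and> (\<forall>T\<in>Bsets H A. \<exists>k::nat. card T = p ^ k)"

definition Bsets_in :: "('a, 'm) monoid_scheme \<Rightarrow> ('a \<Rightarrow> rat) set \<Rightarrow> 'a set \<Rightarrow> 'a set set"
  where "Bsets_in H A L = {T \<in> Bsets H A. T \<subseteq> L}"

definition O_theta :: "('a, 'm) monoid_scheme \<Rightarrow> ('a \<Rightarrow> rat) set \<Rightarrow> 'a set"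
  where "O_theta H A = generate H (\<Union>T\<in>Bsets H A. set_inv\<^bsub>H\<^esub> T <#>\<^bsub>H\<^esub> T)"

definition right_stab :: "('a, 'm) monoid_scheme \<Rightarrow> 'a set \<Rightarrow> 'a set"
  where "right_stab H T = {h \<in> carrier H. T #>\<^bsub>H\<^esub> h = T}"

definition group_center :: "('a, 'm) monoid_scheme \<Rightarrow> 'a set"
  where "group_center H =
    {z \<in> carrier H. \<forall>h\<in>carrier H. z \<otimes>\<^bsub>H\<^esub> h = h \<otimes>\<^bsub>H\<^esub> z}"

end

theory Submission
  imports Defs "HOL-Algebra.Multiplicative_Group"
begin

text \<open>
  Write \<open>L\<close> for the thin residue, and call a basic set outer if it is not contained in \<open>L\<close>.  A basic
  set \<open>T\<close> lies in the coset \<open>tL\<close> of each of its elements \<open>t\<close>, because \<open>t\<inverse>T \<subseteq> T\<inverse>T\<close>.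

  The presentations show that the order of \<open>H\<close> divides \<open>p\<^sup>3\<close>.  A non-commutative subalgebra needs a
  non-abelian \<open>H\<close>, and groups whose order divides \<open>p\<^sup>2\<close> are abelian (\<open>order_dvd_prime_square_imp_comm\<close>),
  so the order is exactly \<open>p\<^sup>3\<close>.  As \<open>p\<close> is odd, there are at least two different stabilizers of outer
  basic sets.  As a coset of \<open>L\<close> contains a set of size \<open>p\<close>, the order of \<open>L\<close> is at least \<open>p\<close>; if it
  were \<open>p\<close>, every outer basic set would be a full coset of \<open>L\<close>, with stabilizer \<open>L\<close>.  And \<open>L\<close> is not
  all of \<open>H\<close>, as outer basic sets exist.  Hence \<open>L\<close> has order \<open>p\<^sup>2\<close> (\<open>card_residue\<close>), is abelian, and is a
  maximal subgroup.

  The main tool is propagation (\<open>cosets_A_sets_propagate\<close>).  Let \<open>K\<close> be a subgroup of order \<open>p\<close>.  The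
  elements \<open>x\<close> such that \<open>xK = Kx\<close> is a union of basic sets are closed under multiplication, so if they
  include \<open>L\<close> and one element outside of \<open>L\<close>, they are all of \<open>H\<close>.  Then every outer basic set is a
  coset of \<open>K\<close> and has stabilizer \<open>K\<close>, against the existence of two stabilizers
  (\<open>no_propagating_subgroup\<close>).  This contradiction is used twice.

  \<^item> The thin radical, the group of the singleton basic sets, is contained in \<open>L\<close>, and its order is
    divisible by \<open>p\<close> since all other basic sets have sizes divisible by \<open>p\<close>.  If its order were only \<open>p\<close>,
    then the basic sets in the rest of \<open>L\<close> would be its cosets, and the only possible non-trivial
    stabilizer of an outer basic set would be the thin radical itself.  Some outer \<open>T\<close> has a non-trivial
    stabilizer; comparing \<open>T\<close> and \<open>T\<inverse>\<close> shows that propagation applies to the thin radical.  So every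
    element of \<open>L\<close> is a singleton basic set (\<open>thin_eq_residue\<close>).
  \<^item> An outer basic set \<open>T\<close> is now a coset \<open>tM\<close> of its stabilizer \<open>M\<close>, of order \<open>p\<close>.  If \<open>M\<close> contained the
    central element \<open>z\<close>, it would be generated by \<open>z\<close> and central, and propagation would apply to \<open>M\<close>
    (\<open>central_not_in_stab\<close>).

  Finally \<open>z\<close> lies in \<open>L\<close>, since otherwise \<open>H\<close> would be abelian.  So the translates \<open>T\<^sub>i z\<^sup>j\<close> are basic
  sets.  They have the stabilizer of \<open>T\<^sub>i\<close>, and \<open>T\<^sub>i\<close> is not fixed by \<open>z\<^sup>j\<close> for \<open>0 < j < p\<close>; therefore
  they are \<open>(p - 1) p\<close> different sets of size \<open>p\<close>, and these fill the complement of \<open>L\<close>.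
\<close>

section \<open>Finite groups\<close>

lemma (in group) cancel_inv_left:
  assumes "x \<in> carrier G" "y \<in> carrier G"
  shows "inv x \<otimes> (x \<otimes> y) = y" "x \<otimes> (inv x \<otimes> y) = y"
  using assms by (simp_all flip: m_assoc)

lemma (in group) card_subgroup_dvd:
  assumes A: "subgroup A G" and B: "subgroup B G" and "A \<subseteq> B"
  shows "card A dvd card B"
proof -
  interpret B: group "G\<lparr>carrier := B\<rparr>"
    by (rule subgroup.subgroup_is_group[OF B is_group])
  have "subgroup A (G\<lparr>carrier := B\<rparr>)"
    using assms by (intro subgroup_incl)
  then have "card (rcosets\<^bsub>G\<lparr>carrier := B\<rparr>\<^esub> A) * card A = card B"
    using B.lagrange by (simp add: order_def)
  then show ?thesis by (metis dvd_triv_right)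
qed

text \<open>
  If \<open>g\<close> normalizes \<open>N = \<langle>S\<rangle>\<close> and \<open>d\<close> is the least positive exponent with \<open>g\<^sup>d \<in> N\<close>, then the elements
  \<open>x g\<^sup>i\<close> with \<open>x \<in> N\<close> and \<open>i < d\<close> are pairwise different and form the group generated by \<open>N\<close> and \<open>g\<close>;
  and \<open>d\<close> divides every \<open>n\<close> with \<open>g\<^sup>n \<in> N\<close>.  Applied generator by generator, this bounds the order of a
  polycyclic group by its relations.  The one inclusion \<open>g N g\<inverse> \<subseteq> N\<close> suffices, as negative powers of \<open>g\<close>
  reduce to positive ones by means of \<open>g\<^sup>d \<in> N\<close>.
\<close>

lemma (in group) card_generate_insert:
  assumes S: "S \<subseteq> carrier G" and g: "g \<in> carrier G" and fin: "finite (generate G S)"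
    and conj: "\<And>s. s \<in> S \<Longrightarrow> g \<otimes> s \<otimes> inv g \<in> generate G S"
    and n: "g [^] n \<in> generate G S" "0 < (n::nat)"
  shows "finite (generate G (insert g S))"
    and "card (generate G (insert g S)) dvd n * card (generate G S)"
proof -
  define N where "N = generate G S"
  have N: "subgroup N G"
    unfolding N_def by (rule generate_is_subgroup[OF S])
  note Nc = subgroup.mem_carrier[OF N]
  have conjN: "g \<otimes> x \<otimes> inv g \<in> N" if "x \<in> N" for x
    using that unfolding N_def
  proof (induction rule: generate.induct)
    case one
    then show ?case using g generate.one by simp
  next
    case (incl h)
    then show ?case by (rule conj)
  next
    case (inv h)
    then have h: "h \<in> carrier G" using S by auto
    have "inv (g \<otimes> h \<otimes> inv g) \<in> generate G S"
      using conj[OF inv] generate_m_inv_closed[OF S] by blast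
    also have "inv (g \<otimes> h \<otimes> inv g) = g \<otimes> inv h \<otimes> inv g"
      using g h by (simp add: inv_mult_group m_assoc)
    finally show ?case .
  next
    case (eng h1 h2)
    have h: "h1 \<in> carrier G" "h2 \<in> carrier G"
      using eng.hyps Nc unfolding N_def by auto
    have "(g \<otimes> h1 \<otimes> inv g) \<otimes> (g \<otimes> h2 \<otimes> inv g) = g \<otimes> (h1 \<otimes> h2) \<otimes> inv g"
      using g h by (simp add: m_assoc cancel_inv_left)
    then show ?case
      using generate.eng[OF eng.IH] by simp
  qed
  have conjk: "g [^] (k::nat) \<otimes> x \<otimes> inv (g [^] k) \<in> N" if "x \<in> N" for x k
  proof (induction k)
    case 0
    then show ?case using that Nc by simp
  next
    case (Suc k)
    have "g [^] Suc k \<otimes> x \<otimes> inv (g [^] Suc k) = g \<otimes> (g [^] k \<otimes> x \<otimes> inv (g [^] k)) \<otimes> inv g"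
      using g Nc[OF that] by (simp only: nat_pow_Suc2) (simp add: inv_mult_group m_assoc)
    then show ?case using conjN[OF Suc] by simp
  qed
  have push: "g [^] k \<otimes> x = (g [^] k \<otimes> x \<otimes> inv (g [^] k)) \<otimes> g [^] k"
    if "x \<in> N" for x and k :: nat
    using g Nc[OF that] by (simp add: m_assoc)
  define d where "d = (LEAST d. 0 < d \<and> g [^] (d::nat) \<in> N)"
  have d: "0 < d" "g [^] d \<in> N"
    using LeastI[of "\<lambda>d. 0 < d \<and> g [^] d \<in> N" n] n unfolding d_def N_def by auto
  have d_min: "d \<le> k" if "0 < k" "g [^] k \<in> N" for k :: nat
    unfolding d_def using that by (intro Least_le) auto
  have dq: "g [^] (d * q) \<in> N" for q
  proof (induction q)
    case (Suc q)
    have "g [^] (d * Suc q) = g [^] d \<otimes> g [^] (d * q)"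
      using g by (simp add: nat_pow_mult)
    then show ?case using subgroup.m_closed[OF N d(2) Suc] by simp
  qed (use subgroup.one_closed[OF N] in simp)
  have decomp: "g [^] k = g [^] (d * (k div d)) \<otimes> g [^] (k mod d)" for k
    using g by (simp add: nat_pow_mult)
  have "d dvd n"
  proof (rule ccontr)
    assume "\<not> d dvd n"
    then have pos: "0 < n mod d" by (simp add: dvd_eq_mod_eq_0)
    have "g [^] (n mod d) = inv (g [^] (d * (n div d))) \<otimes> g [^] n"
      using decomp[of n] g by (simp add: inv_solve_left)
    also have "\<dots> \<in> N"
      using n(1) dq N unfolding N_def
      by (intro subgroup.m_closed subgroup.m_inv_closed) auto
    finally show False
      using d_min[OF pos] mod_less_divisor[OF d(1), of n] by simp
  qed
  define M where "M = (\<lambda>(x, i). x \<otimes> g [^] i) ` (N \<times> {..<d})"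
  have M_I: "x \<otimes> g [^] k \<in> M" if "x \<in> N" for x and k :: nat
  proof -
    have "x \<otimes> g [^] k = (x \<otimes> g [^] (d * (k div d))) \<otimes> g [^] (k mod d)"
      using decomp[of k] g Nc[OF that] by (simp add: m_assoc)
    moreover have "x \<otimes> g [^] (d * (k div d)) \<in> N"
      using that dq by (rule subgroup.m_closed[OF N])
    ultimately show ?thesis
      unfolding M_def using d(1) by (auto intro!: image_eqI[of _ _ "(x \<otimes> g [^] (d * (k div d)), k mod d)"])
  qed
  have M_E: "\<exists>x i. x \<in> N \<and> i < d \<and> y = x \<otimes> g [^] i" if "y \<in> M" for y
    using that unfolding M_def by auto
  have M: "subgroup M G"
  proof (rule subgroupI)
    show "M \<subseteq> carrier G" using Nc g by (auto simp: M_def)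
    show "M \<noteq> {}" using M_I[OF subgroup.one_closed[OF N]] by blast
    fix a assume "a \<in> M"
    then obtain x i where a: "x \<in> N" "i < d" "a = x \<otimes> g [^] i" using M_E by blast
    have w: "inv (g [^] d) \<otimes> inv x \<in> N"
      using a d N by (intro subgroup.m_closed subgroup.m_inv_closed) auto
    have "g [^] d = g [^] i \<otimes> g [^] (d - i)"
      using a g by (simp add: nat_pow_mult)
    then have "inv (g [^] i) = g [^] (d - i) \<otimes> inv (g [^] d)"
      using g by (simp add: inv_mult_group m_assoc[symmetric])
    then have "inv a = g [^] (d - i) \<otimes> (inv (g [^] d) \<otimes> inv x)"
      using a g Nc[OF a(1)] by (simp add: inv_mult_group m_assoc)
    also have "\<dots> \<in> M"
      by (subst push[OF w]) (rule M_I[OF conjk[OF w]])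
    finally show "inv a \<in> M" .
  next
    fix a b assume "a \<in> M" "b \<in> M"
    then obtain x y and i j :: nat where a: "x \<in> N" "a = x \<otimes> g [^] i" "y \<in> N" "b = y \<otimes> g [^] j"
      by (auto dest!: M_E)
    have "a \<otimes> b = x \<otimes> (g [^] i \<otimes> y) \<otimes> g [^] j"
      using a g Nc by (simp add: m_assoc)
    also have "\<dots> = x \<otimes> ((g [^] i \<otimes> y \<otimes> inv (g [^] i)) \<otimes> g [^] i) \<otimes> g [^] j"
      using push[OF a(3)] by simp
    also have "\<dots> = (x \<otimes> (g [^] i \<otimes> y \<otimes> inv (g [^] i))) \<otimes> g [^] (i + j)"
      using Nc[OF a(1)] Nc[OF conjk[OF a(3)]] g by (simp add: m_assoc nat_pow_mult)
    also have "\<dots> \<in> M"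
      by (intro M_I subgroup.m_closed[OF N] a conjk)
    finally show "a \<otimes> b \<in> M" .
  qed
  have NM: "N \<subseteq> M"
  proof
    fix x assume "x \<in> N"
    then show "x \<in> M" using M_I[of x 0] Nc by simp
  qed
  have "S \<subseteq> N"
    unfolding N_def by (auto intro: generate.incl)
  moreover have "g \<in> M"
    using M_I[OF subgroup.one_closed[OF N], of 1] g by simp
  ultimately have "generate G (insert g S) \<subseteq> M"
    using NM M by (intro generate_subgroup_incl) auto
  moreover have "M \<subseteq> generate G (insert g S)"
  proof
    fix y assume "y \<in> M"
    then obtain x i where y: "x \<in> N" "y = x \<otimes> g [^] (i::nat)" using M_E by blast
    have sub: "subgroup (generate G (insert g S)) G"
      using S g by (intro generate_is_subgroup) auto
    have "x \<in> generate G (insert g S)"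
      using y(1) mono_generate[of S "insert g S"] unfolding N_def by blast
    moreover have "g [^] i \<in> generate G (insert g S)"
      by (induction i) (auto intro: generate.intros)
    ultimately show "y \<in> generate G (insert g S)"
      unfolding y by (rule subgroup.m_closed[OF sub])
  qed
  ultimately have eq: "generate G (insert g S) = M" by blast
  show "finite (generate G (insert g S))"
    unfolding eq M_def using fin by (auto simp: N_def)
  have no: False
    if "x \<in> N" "y \<in> N" "x \<otimes> g [^] i = y \<otimes> g [^] j" "i < j" "j < d" for x y and i j :: nat
  proof -
    have "g [^] j = g [^] (j - i) \<otimes> g [^] i"
      using that g by (simp add: nat_pow_mult)
    with that have "x = y \<otimes> g [^] (j - i)"
      using g Nc by (simp add: m_assoc[symmetric])
    then have "g [^] (j - i) = inv y \<otimes> x"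
      using g Nc that by (simp add: inv_solve_left)
    then have "g [^] (j - i) \<in> N"
      using that N by (simp add: subgroup.m_closed subgroup.m_inv_closed)
    from d_min[OF _ this] show False using that by simp
  qed
  have "inj_on (\<lambda>(x, i). x \<otimes> g [^] i) (N \<times> {..<d})"
  proof (rule inj_onI, clarsimp)
    fix x y and i j :: nat
    assume *: "x \<in> N" "y \<in> N" "i < d" "j < d" "x \<otimes> g [^] i = y \<otimes> g [^] j"
    then have "i = j"
      using no[of x y i j] no[of y x j i] by (metis linorder_neqE_nat)
    with * show "x = y \<and> i = j"
      using g Nc by simp
  qed
  then have "card M = card N * d"
    unfolding M_def by (subst card_image) (auto simp: card_cartesian_product)
  then show "card (generate G (insert g S)) dvd n * card (generate G S)"
    unfolding eq using \<open>d dvd n\<close> by (simp add: N_def mult_dvd_mono mult.commute)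
qed

text \<open>
  Let \<open>\<langle>x\<rangle>\<close> and \<open>\<langle>y\<rangle>\<close> be incomparable; then both have order \<open>p\<close> in a group of order \<open>p\<^sup>2\<close>.  Each is
  normalized by the generator of the other: if \<open>P = \<langle>u\<rangle>\<close> differed from its conjugate \<open>v\<inverse> P v\<close>, the
  products \<open>a (v\<inverse> b v)\<close> with \<open>a, b \<in> P\<close> would be \<open>p\<^sup>2\<close> different elements, so one of them would be \<open>v\<close>,
  which gives \<open>v = b a \<in> P\<close>.  Hence the commutator of \<open>x\<close> and \<open>y\<close> lies in \<open>\<langle>x\<rangle> \<inter> \<langle>y\<rangle> = 1\<close>.
\<close>

lemma (in group) order_dvd_prime_square_imp_comm:
  assumes p: "prime p" and fin: "finite (carrier G)" and ord: "order G dvd p\<^sup>2"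
    and xy: "x \<in> carrier G" "y \<in> carrier G"
  shows "x \<otimes> y = y \<otimes> x"
proof -
  define C where "C = (\<lambda>x. generate G {x})"
  have sub: "subgroup (C u) G" if "u \<in> carrier G" for u
    unfolding C_def using that by (intro generate_is_subgroup) auto
  have self: "u \<in> C u" for u
    unfolding C_def by (rule generate.incl) simp
  have comm: "v \<otimes> w = w \<otimes> v" if u: "u \<in> carrier G" and vw: "v \<in> C u" "w \<in> C u" for u v w
  proof -
    obtain i j :: int where "v = u [^] i" "w = u [^] j"
      using generate_pow[OF u] vw by (auto simp: C_def)
    then show ?thesis
      using u by (simp add: int_pow_mult[symmetric] add.commute)
  qed
  consider "x \<in> C y" | "y \<in> C x" | "x \<notin> C y" "y \<notin> C x" by blast
  then show ?thesis
  proof cases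
    case 1 then show ?thesis using comm[OF xy(2)] self by blast
  next
    case 2 then show ?thesis using comm[OF xy(1)] self by blast
  next
    case 3
    have card_C: "card (C u) = p \<and> order G = p\<^sup>2"
      if "u \<in> carrier G" "v \<in> carrier G" "v \<notin> C u" "u \<notin> C v" for u v
    proof -
      have sC: "C u \<subset> carrier G" using subgroup.subset[OF sub[OF that(1)]] that by blast
      have l: "card (rcosets (C u)) * card (C u) = order G"
        by (rule lagrange[OF sub[OF that(1)]])
      have less: "card (C u) < order G"
        using psubset_card_mono[OF fin sC] by (simp add: order_def)
      obtain i where i: "i \<le> 2" "order G = p ^ i" using ord divides_primepow_nat[OF p] by blast
      obtain j where j: "j \<le> i" "card (C u) = p ^ j"
        using l i divides_primepow_nat[OF p] by (metis dvd_triv_right)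
      have "j \<noteq> 0"
      proof
        assume "j = 0"
        then have "card (C u) = 1" using j by simp
        then have "C u = {\<one>}"
          using subgroup.one_closed[OF sub[OF that(1)]] by (metis card_1_singletonE singletonD)
        then have "u = \<one>" using self by blast
        then show False using that(2,4) subgroup.one_closed[OF sub[OF that(2)]] by simp
      qed
      moreover have "j < i" using less i j prime_gt_1_nat[OF p] by (metis nat_less_le less_irrefl)
      ultimately have "j = 1 \<and> i = 2" using i j by linarith
      then show ?thesis using i j by simp
    qed
    have inter: "C u \<inter> K = {\<one>}" if u: "u \<in> carrier G" "card (C u) = p"
      and K: "subgroup K G" and nsub: "\<not> C u \<subseteq> K" for u K
    proof -
      have s: "subgroup (C u \<inter> K) G" by (rule subgroups_Inter_pair[OF sub[OF u(1)] K])
      have "finite (C u)" using fin subgroup.subset[OF sub[OF u(1)]] finite_subset by blast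
      have "card (C u \<inter> K) dvd card (C u)"
        by (rule card_subgroup_dvd[OF s sub[OF u(1)]]) simp
      moreover have "card (C u \<inter> K) < card (C u)"
        using nsub \<open>finite (C u)\<close> by (intro psubset_card_mono) auto
      ultimately have "card (C u \<inter> K) = 1"
        using u(2) p by (metis less_irrefl prime_nat_iff)
      then show ?thesis
        using subgroup.one_closed[OF s] by (metis card_1_singletonE singletonD)
    qed
    have norm: "inv v \<otimes> u \<otimes> v \<in> C u"
      if u: "u \<in> carrier G" "v \<in> carrier G" "v \<notin> C u" "u \<notin> C v" for u v
    proof (rule ccontr)
      assume no: "inv v \<otimes> u \<otimes> v \<notin> C u"
      note P = sub[OF u(1)]
      note Pc = subgroup.mem_carrier[OF P]
      \<comment> \<open>Conjugation by \<open>v\<close> takes \<open>u\<close> out of \<open>C u\<close>, so \<open>C u \<inter> D\<close> is a proper subgroup of \<open>C u\<close>.\<close>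
      define D where "D = {c \<in> carrier G. inv v \<otimes> c \<otimes> v \<in> C u}"
      have mult: "inv v \<otimes> (c \<otimes> e) \<otimes> v = (inv v \<otimes> c \<otimes> v) \<otimes> (inv v \<otimes> e \<otimes> v)"
        if "c \<in> carrier G" "e \<in> carrier G" for c e
        using u that by (simp add: m_assoc cancel_inv_left)
      have D: "subgroup D G"
      proof (rule subgroupI)
        show "D \<subseteq> carrier G" by (auto simp: D_def)
        show "D \<noteq> {}" using subgroup.one_closed[OF P] u by (auto simp: D_def intro!: exI[of _ \<one>])
        fix c assume c: "c \<in> D"
        then have "inv (inv v \<otimes> c \<otimes> v) \<in> C u"
          using P by (auto simp: D_def intro: subgroup.m_inv_closed)
        moreover have "inv (inv v \<otimes> c \<otimes> v) = inv v \<otimes> inv c \<otimes> v"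
          using c u by (simp add: D_def inv_mult_group m_assoc)
        ultimately show "inv c \<in> D"
          using c by (simp add: D_def)
      next
        fix c e assume "c \<in> D" "e \<in> D"
        then show "c \<otimes> e \<in> D"
          using mult P by (auto simp: D_def subgroup.m_closed)
      qed
      have u_D: "u \<notin> D" using no u by (simp add: D_def)
      have PD: "C u \<inter> D = {\<one>}"
        using u_D self[of u] card_C[OF u] by (intro inter[OF u(1) _ D]) blast+
      have "inj_on (\<lambda>(a, b). a \<otimes> (inv v \<otimes> b \<otimes> v)) (C u \<times> C u)"
      proof (rule inj_onI, clarsimp)
        fix a b a' b'
        assume ab: "a \<in> C u" "b \<in> C u" "a' \<in> C u" "b' \<in> C u"
          and eq: "a \<otimes> (inv v \<otimes> b \<otimes> v) = a' \<otimes> (inv v \<otimes> b' \<otimes> v)"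
        then have c: "a \<in> carrier G" "b \<in> carrier G" "a' \<in> carrier G" "b' \<in> carrier G"
          by (simp_all add: Pc)
        have "inv v \<otimes> (b \<otimes> inv b') \<otimes> v = inv a \<otimes> (a \<otimes> (inv v \<otimes> b \<otimes> v)) \<otimes> inv (inv v \<otimes> b' \<otimes> v)"
          using u(1,2) c by (simp add: m_assoc inv_mult_group cancel_inv_left)
        also have "\<dots> = inv a \<otimes> a'"
          unfolding eq using u(1,2) c by (simp add: m_assoc)
        also have "\<dots> \<in> C u"
          using ab P by (simp add: subgroup.m_closed subgroup.m_inv_closed)
        finally have "b \<otimes> inv b' \<in> D"
          using c by (simp add: D_def)
        moreover have "b \<otimes> inv b' \<in> C u"
          using ab P by (simp add: subgroup.m_closed subgroup.m_inv_closed)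
        ultimately have "b \<otimes> inv b' = \<one>" using PD by blast
        then have "b \<otimes> inv b' \<otimes> b' = b'" using c by simp
        then have b: "b = b'" using c by (simp add: m_assoc)
        then have "a = a'" using eq c u(1,2) by simp
        with b show "a = a' \<and> b = b'" by blast
      qed
      then have "card ((\<lambda>(a, b). a \<otimes> (inv v \<otimes> b \<otimes> v)) ` (C u \<times> C u)) = card (carrier G)"
        using card_C[OF u] by (simp add: card_image card_cartesian_product power2_eq_square order_def)
      then have "(\<lambda>(a, b). a \<otimes> (inv v \<otimes> b \<otimes> v)) ` (C u \<times> C u) = carrier G"
        using u Pc fin by (intro card_subset_eq) auto
      then obtain a b where ab: "a \<in> C u" "b \<in> C u" "v = a \<otimes> (inv v \<otimes> b \<otimes> v)"
        using u(2) by force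
      then have c: "a \<in> carrier G" "b \<in> carrier G"
        by (simp_all add: Pc)
      have "v \<otimes> inv v = a \<otimes> (inv v \<otimes> b \<otimes> v) \<otimes> inv v"
        using ab(3) by simp
      then have "b \<otimes> \<one> \<otimes> inv b = b \<otimes> (a \<otimes> inv v \<otimes> b) \<otimes> inv b"
        using u(1,2) c by (simp add: m_assoc)
      then have "inv (b \<otimes> a) \<otimes> \<one> = inv (b \<otimes> a) \<otimes> (b \<otimes> a \<otimes> inv v)"
        using u(1,2) c by (simp add: m_assoc)
      then have "inv (b \<otimes> a) = inv v"
        using u(1,2) c by (simp add: m_assoc inv_mult_group cancel_inv_left)
      then have "v = b \<otimes> a"
        using u(1,2) c by (metis inv_inv m_closed)
      then show False
        using that(3) ab P by (simp add: subgroup.m_closed)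
    qed
    \<comment> \<open>The commutator, bracketed in two ways: as an element of \<open>C y\<close> and as an element of \<open>C x\<close>.\<close>
    have "inv x \<otimes> y \<otimes> x \<in> C y"
      using norm[OF xy(2,1)] 3 by blast
    then have "inv (inv x \<otimes> y \<otimes> x) \<otimes> y \<in> C y"
      using sub[OF xy(2)] self by (simp add: subgroup.m_closed subgroup.m_inv_closed)
    moreover have "inv (inv x \<otimes> y \<otimes> x) \<otimes> y = inv x \<otimes> (inv y \<otimes> x \<otimes> y)"
      using xy by (simp add: inv_mult_group m_assoc)
    moreover have "inv x \<otimes> (inv y \<otimes> x \<otimes> y) \<in> C x"
      using norm[OF xy] 3 sub[OF xy(1)] self by (simp add: subgroup.m_closed subgroup.m_inv_closed)
    moreover have "C x \<inter> C y = {\<one>}"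
      using card_C[OF xy] 3 self by (intro inter xy sub) blast+
    ultimately have "inv x \<otimes> (inv y \<otimes> x \<otimes> y) = \<one>" by auto
    then have "y \<otimes> (x \<otimes> (inv x \<otimes> (inv y \<otimes> x \<otimes> y))) = y \<otimes> (x \<otimes> \<one>)"
      by simp
    then show ?thesis
      using xy by (simp add: m_assoc cancel_inv_left)
  qed
qed

lemma iso_finite_card:
  assumes "G \<cong> K" "finite (carrier K)"
  shows "finite (carrier G)" "card (carrier G) = card (carrier K)"
proof -
  obtain f where "bij_betw f (carrier G) (carrier K)"
    using assms(1) by (auto simp: is_iso_def iso_def)
  then show "finite (carrier G)" "card (carrier G) = card (carrier K)"
    using assms(2) by (auto simp: bij_betw_finite bij_betw_same_card)
qed

lemma (in group) finite_submonoid_is_subgroup: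
  assumes "finite (carrier G)" and X: "X \<subseteq> carrier G" and "\<one> \<in> X"
    and closed: "\<And>x y. x \<in> X \<Longrightarrow> y \<in> X \<Longrightarrow> x \<otimes> y \<in> X"
  shows "subgroup X G"
proof (rule subgroupI)
  fix x assume x: "x \<in> X"
  have pow: "x [^] (n::nat) \<in> X" for n
    by (induction n) (simp_all add: \<open>\<one> \<in> X\<close> closed x)
  have "x [^] (order G - 1) \<otimes> x = x [^] order G"
    using assms(1) order_gt_0_iff_finite by (metis Suc_diff_1 nat_pow_Suc)
  then have "inv x = x [^] (order G - 1)"
    using x X pow_order_eq_1 by (intro inv_equality) auto
  then show "inv x \<in> X" using pow by simp
qed (use assms in auto)

lemma (in group) subgroup_prime_order_cases:
  assumes K: "subgroup K G" and p: "prime (card K)" and M: "subgroup M G"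
  shows "K \<subseteq> M \<or> K \<inter> M = {\<one>}"
proof -
  have KM: "subgroup (K \<inter> M) G" by (rule subgroups_Inter_pair[OF K M])
  then have "card (K \<inter> M) dvd card K"
    by (rule card_subgroup_dvd[OF _ K]) simp
  then consider "card (K \<inter> M) = 1" | "card (K \<inter> M) = card K"
    using p by (metis prime_nat_iff)
  then show ?thesis
  proof cases
    case 1
    then show ?thesis
      using subgroup.one_closed[OF KM] by (metis card_1_singletonE singletonD)
  next
    case 2
    have "finite K" using p by (metis card.infinite not_prime_0)
    from card_subset_eq[OF this _ 2] show ?thesis by auto
  qed
qed

lemma (in group) subgroup_mem_of_coprime_pow:
  assumes M: "subgroup M G" and x: "x \<in> carrier G" and "coprime m n"
    and "x [^] (m::nat) \<in> M" "x [^] (n::nat) \<in> M"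
  shows "x \<in> M"
proof -
  obtain u v where uv: "u * int m + v * int n = 1"
    using bezout_int[of "int m" "int n"] assms(3) by auto
  have "x = x [^] (u * int m + v * int n)"
    using x uv by simp
  also have "\<dots> = (x [^] m) [^] u \<otimes> (x [^] n) [^] v"
    using x by (simp add: int_pow_mult int_pow_pow mult.commute flip: int_pow_int)
  also have "\<dots> \<in> M"
    using assms by (intro subgroup.m_closed[OF M] subgroup_int_pow_closed)
  finally show ?thesis .
qed

lemma (in group) maximal_subgroup:
  assumes p: "prime p" and ord: "order G = p ^ Suc n" and L: "card L = p ^ n"
    and X: "subgroup X G" and "L \<subset> X"
  shows "X = carrier G"
proof -
  have fin: "finite (carrier G)"
    using ord p order_gt_0_iff_finite by (simp add: prime_gt_0_nat)
  have finX: "finite X" using subgroup.subset[OF X] fin finite_subset by blast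
  have "card X dvd p ^ Suc n"
    using card_subgroup_dvd[OF X subgroup_self] subgroup.subset[OF X] ord by (simp add: order_def)
  then obtain i where i: "i \<le> Suc n" "card X = p ^ i"
    using divides_primepow_nat[OF p] by blast
  have "p ^ n < p ^ i"
    using psubset_card_mono[OF finX \<open>L \<subset> X\<close>] L i by simp
  then have "n < i" using prime_gt_1_nat[OF p] by simp
  then have "i = Suc n" using i by simp
  then have "card X = card (carrier G)" using i ord by (simp add: order_def)
  then show ?thesis using fin subgroup.subset[OF X] card_subset_eq by blast
qed

lemma (in group) centralizer_subgroup:
  assumes "S \<subseteq> carrier G"
  shows "subgroup {c \<in> carrier G. \<forall>s\<in>S. c \<otimes> s = s \<otimes> c} G"
proof (rule subgroupI)
  fix a assume a: "a \<in> {c \<in> carrier G. \<forall>s\<in>S. c \<otimes> s = s \<otimes> c}"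
  have "inv a \<otimes> s = s \<otimes> inv a" if "s \<in> S" for s
  proof -
    have c: "a \<in> carrier G" "s \<in> carrier G" "a \<otimes> s = s \<otimes> a" using a that assms by auto
    then have "inv a \<otimes> (a \<otimes> s) \<otimes> inv a = inv a \<otimes> (s \<otimes> a) \<otimes> inv a" by simp
    then show ?thesis using c(1,2) by (simp add: m_assoc cancel_inv_left)
  qed
  with a show "inv a \<in> {c \<in> carrier G. \<forall>s\<in>S. c \<otimes> s = s \<otimes> c}" by simp
next
  fix a b assume "a \<in> {c \<in> carrier G. \<forall>s\<in>S. c \<otimes> s = s \<otimes> c}" "b \<in> {c \<in> carrier G. \<forall>s\<in>S. c \<otimes> s = s \<otimes> c}"
  then have ab: "a \<in> carrier G" "b \<in> carrier G" "\<And>s. s \<in> S \<Longrightarrow> a \<otimes> s = s \<otimes> a"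
    "\<And>s. s \<in> S \<Longrightarrow> b \<otimes> s = s \<otimes> b" by auto
  have "a \<otimes> b \<otimes> s = s \<otimes> (a \<otimes> b)" if "s \<in> S" for s
  proof -
    have s: "s \<in> carrier G" using that assms by auto
    have "a \<otimes> b \<otimes> s = a \<otimes> (b \<otimes> s)" using ab(1,2) s by (simp add: m_assoc)
    also have "\<dots> = a \<otimes> s \<otimes> b" unfolding ab(4)[OF that] using ab(1,2) s by (simp add: m_assoc)
    also have "\<dots> = s \<otimes> a \<otimes> b" by (simp only: ab(3)[OF that])
    also have "\<dots> = s \<otimes> (a \<otimes> b)" using ab(1,2) s by (simp add: m_assoc)
    finally show ?thesis .
  qed
  with ab(1,2) show "a \<otimes> b \<in> {c \<in> carrier G. \<forall>s\<in>S. c \<otimes> s = s \<otimes> c}" by simp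
qed (use assms in \<open>auto simp: subset_iff intro!: exI[of _ \<one>]\<close>)

text \<open>
  A central element outside of \<open>L\<close> makes the centralizer of \<open>L\<close> larger than \<open>L\<close>, hence all of \<open>G\<close>; so
  \<open>L\<close> is central, the center is larger than \<open>L\<close>, and \<open>G\<close> is abelian.
\<close>

lemma (in group) central_in_maximal_abelian:
  assumes p: "prime p" and ord: "order G = p ^ Suc n" and L: "card L = p ^ n" "L \<subseteq> carrier G"
    and comm: "\<And>x y. x \<in> L \<Longrightarrow> y \<in> L \<Longrightarrow> x \<otimes> y = y \<otimes> x"
    and z: "z \<in> group_center G"
    and nonab: "\<exists>x\<in>carrier G. \<exists>y\<in>carrier G. x \<otimes> y \<noteq> y \<otimes> x"
  shows "z \<in> L"
proof (rule ccontr)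
  assume "z \<notin> L"
  have zc: "z \<in> carrier G" "\<And>h. h \<in> carrier G \<Longrightarrow> z \<otimes> h = h \<otimes> z"
    using z by (auto simp: group_center_def)
  have all: "{c \<in> carrier G. \<forall>s\<in>S. c \<otimes> s = s \<otimes> c} = carrier G"
    if S: "S \<subseteq> carrier G" and sub: "insert z L \<subseteq> {c \<in> carrier G. \<forall>s\<in>S. c \<otimes> s = s \<otimes> c}" for S
    using \<open>z \<notin> L\<close> sub by (intro maximal_subgroup[OF p ord L(1) centralizer_subgroup[OF S]]) blast
  have "{c \<in> carrier G. \<forall>s\<in>L. c \<otimes> s = s \<otimes> c} = carrier G"
    using L zc comm by (intro all) auto
  then have cen: "c \<otimes> s = s \<otimes> c" if "c \<in> carrier G" "s \<in> L" for c s
    using that by auto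
  have "{c \<in> carrier G. \<forall>s\<in>carrier G. c \<otimes> s = s \<otimes> c} = carrier G"
    using L zc cen by (intro all) auto
  then show False using nonab by auto
qed

section \<open>The orders of the two presented groups\<close>

lemma presented_group_carrier: "pres_class R u \<in> carrier (presented_group R)"
  by (simp add: presented_group_def)

lemma presented_group_one: "\<one>\<^bsub>presented_group R\<^esub> = pres_class R []"
  by (simp add: presented_group_def)

lemma presented_group_pow:
  "pres_class R u [^]\<^bsub>presented_group R\<^esub> (n::nat) = pres_class R (concat (replicate n u))"
proof (induction n)
  case 0
  then show ?case by (simp add: presented_group_one)
next
  case (Suc n)
  have "concat (replicate (Suc n) u) = concat (replicate n u) @ u"
    by (induction n) auto
  then show ?case using Suc
    by (simp add: presented_group_mult)
qed

lemma concat_replicate_single: "concat (replicate n [x]) = replicate n x"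
  by (induction n) auto

lemma presented_group_relation:
  "(u, v) \<in> R \<Longrightarrow> pres_class R u = pres_class R v"
  using pres_rel[of u v R "[]" "[]"] by (simp add: pres_class_eq_iff)

lemma presented_group_letter_inv:
  "inv\<^bsub>presented_group R\<^esub> (pres_class R [(g, True)]) = pres_class R [(g, False)]"
proof -
  interpret group "presented_group R" by (rule group_presented_group)
  have "pres_class R [(g, False)] \<otimes>\<^bsub>presented_group R\<^esub> pres_class R [(g, True)]
      = \<one>\<^bsub>presented_group R\<^esub>"
    using pres_cancel[of R "[]" g False "[]"]
    by (simp add: presented_group_mult presented_group_one pres_class_eq_iff)
  then show ?thesis
    by (rule inv_equality) (rule presented_group_carrier)+
qed

text \<open>
  The form in which the generators are used: no normal form of words is needed to bound the order.
\<close>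

lemma presented_group_generated:
  assumes K: "subgroup K (presented_group R)" and gen: "\<And>g. pres_class R [(g, True)] \<in> K"
  shows "K = carrier (presented_group R)"
proof
  interpret group "presented_group R" by (rule group_presented_group)
  show "K \<subseteq> carrier (presented_group R)" by (rule subgroup.subset[OF K])
  have "pres_class R u \<in> K" for u
  proof (induction u)
    case Nil
    then show ?case using subgroup.one_closed[OF K] by (simp add: presented_group_one)
  next
    case (Cons l u)
    obtain g e where l: "l = (g, e)" by (cases l)
    have "pres_class R [l] \<in> K"
      using gen[of g] subgroup.m_inv_closed[OF K gen[of g]]
      by (cases e) (simp_all add: l presented_group_letter_inv)
    then have "pres_class R [l] \<otimes>\<^bsub>presented_group R\<^esub> pres_class R u \<in> K"
      using Cons by (rule subgroup.m_closed[OF K])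
    then show ?case by (simp add: presented_group_mult)
  qed
  then show "carrier (presented_group R) \<subseteq> K"
    by (auto simp: presented_group_def)
qed

text \<open>
  The chain \<open>1 \<le> \<langle>a\<rangle> \<le> \<langle>a, b\<rangle>\<close>.  The relation \<open>ab = ba\<^sup>p\<^sup>+\<^sup>1\<close> expresses \<open>b\<inverse> a b\<close> as a power of \<open>a\<close>, so \<open>b\<inverse>\<close>
  and not \<open>b\<close> is the generator that is adjoined to \<open>\<langle>a\<rangle>\<close>.
\<close>

lemma card_H1:
  assumes p: "0 < p"
  shows "finite (carrier (H1 p))" and "card (carrier (H1 p)) dvd p ^ 3"
proof -
  define R where "R = {(replicate (p\<^sup>2) (a1, True), []), (replicate p (b1, True), []),
     ([(a1, True), (b1, True)], [(b1, True)] @ replicate (p + 1) (a1, True))}"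
  have H1: "H1 p = presented_group R"
    by (simp add: H1_def R_def Let_def)
  interpret G: group "H1 p" unfolding H1 by (rule group_presented_group)
  define a where "a = pres_class R [(a1, True)]"
  define b where "b = pres_class R [(b1, True)]"
  have ab: "a \<in> carrier (H1 p)" "b \<in> carrier (H1 p)"
    unfolding a_def b_def H1 by (rule presented_group_carrier)+
  have pow: "pres_class R [x] [^]\<^bsub>H1 p\<^esub> (n::nat) = pres_class R (replicate n x)" for x n
    unfolding H1 presented_group_pow concat_replicate_single ..
  have "a [^]\<^bsub>H1 p\<^esub> p\<^sup>2 = pres_class R []"
    unfolding a_def pow by (rule presented_group_relation) (simp add: R_def)
  then have ap: "a [^]\<^bsub>H1 p\<^esub> p\<^sup>2 = \<one>\<^bsub>H1 p\<^esub>"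
    by (simp add: H1 presented_group_one)
  have "b [^]\<^bsub>H1 p\<^esub> p = pres_class R []"
    unfolding b_def pow by (rule presented_group_relation) (simp add: R_def)
  then have bp: "b [^]\<^bsub>H1 p\<^esub> p = \<one>\<^bsub>H1 p\<^esub>"
    by (simp add: H1 presented_group_one)
  have "a \<otimes>\<^bsub>H1 p\<^esub> b = pres_class R ([(a1, True), (b1, True)])"
    by (simp add: a_def b_def H1 presented_group_mult)
  also have "\<dots> = pres_class R ([(b1, True)] @ replicate (p + 1) (a1, True))"
    by (rule presented_group_relation) (simp add: R_def)
  also have "\<dots> = b \<otimes>\<^bsub>H1 p\<^esub> a [^]\<^bsub>H1 p\<^esub> (p + 1)"
    unfolding b_def a_def pow by (simp only: H1 presented_group_mult)
  finally have rel: "a \<otimes>\<^bsub>H1 p\<^esub> b = b \<otimes>\<^bsub>H1 p\<^esub> a [^]\<^bsub>H1 p\<^esub> (p + 1)" .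
  let ?b = "inv\<^bsub>H1 p\<^esub> b"
  have emp: "generate (H1 p) {} = {\<one>\<^bsub>H1 p\<^esub>}"
    using G.generate_incl[of "{}"] G.generate_empty by blast
  have fa: "finite (generate (H1 p) {a})" "card (generate (H1 p) {a}) dvd p\<^sup>2"
    using G.card_generate_insert[of "{}" a "p\<^sup>2"] ab p ap emp by auto
  have pow_a: "a [^]\<^bsub>H1 p\<^esub> (n::nat) \<in> generate (H1 p) {a}" for n
    by (induction n) (auto intro: generate.intros)
  have conj: "?b \<otimes>\<^bsub>H1 p\<^esub> a \<otimes>\<^bsub>H1 p\<^esub> inv\<^bsub>H1 p\<^esub> ?b = a [^]\<^bsub>H1 p\<^esub> (p + 1)"
    using ab rel by (simp add: G.m_assoc G.cancel_inv_left del: G.nat_pow_Suc)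
  have bp': "?b [^]\<^bsub>H1 p\<^esub> p = \<one>\<^bsub>H1 p\<^esub>"
    using bp ab by (simp add: G.nat_pow_inv)
  have "finite (generate (H1 p) {?b, a}) \<and>
      card (generate (H1 p) {?b, a}) dvd p * card (generate (H1 p) {a})"
    using ab conj pow_a[of "p + 1"] bp' fa p
    by (intro conjI G.card_generate_insert[where S = "{a}" and g = ?b]) (auto intro: generate.one)
  moreover have "generate (H1 p) {?b, a} = carrier (H1 p)"
  proof -
    have sub: "subgroup (generate (H1 p) {?b, a}) (H1 p)"
      using ab by (intro G.generate_is_subgroup) auto
    have "?b \<in> generate (H1 p) {?b, a}" "a \<in> generate (H1 p) {?b, a}"
      by (auto intro: generate.incl)
    then have "b \<in> generate (H1 p) {?b, a}" "a \<in> generate (H1 p) {?b, a}"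
      using subgroup.m_inv_closed[OF sub, of ?b] ab by auto
    then have "pres_class R [(g, True)] \<in> generate (H1 p) {?b, a}" for g
      by (cases g) (auto simp: a_def b_def)
    then show ?thesis
      using sub unfolding H1 by (intro presented_group_generated) auto
  qed
  ultimately have "finite (carrier (H1 p))"
    "card (carrier (H1 p)) dvd p * card (generate (H1 p) {a})" by auto
  then show "finite (carrier (H1 p))" "card (carrier (H1 p)) dvd p ^ 3"
    using mult_dvd_mono[OF dvd_refl[of p] fa(2)]
    by (auto simp: power3_eq_cube power2_eq_square intro: dvd_trans)
qed

text \<open>
  The chain \<open>1 \<le> \<langle>c\<rangle> \<le> \<langle>a, c\<rangle> \<le> \<langle>a, b, c\<rangle>\<close>.  The relation \<open>[a, b] = c\<close> reads \<open>b\<inverse> a b = a c\<close>, so again the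
  inverse of \<open>b\<close> is adjoined.
\<close>

lemma card_H2:
  assumes p: "0 < p"
  shows "finite (carrier (H2 p))" and "card (carrier (H2 p)) dvd p ^ 3"
proof -
  define R where "R = {(replicate p (a2, True), []), (replicate p (b2, True), []),
     (replicate p (c2, True), []), (comm_word a2 b2, [(c2, True)]), (comm_word a2 c2, []),
     (comm_word b2 c2, [])}"
  have H2: "H2 p = presented_group R"
    by (simp add: H2_def R_def)
  interpret G: group "H2 p" unfolding H2 by (rule group_presented_group)
  define x where "x g = pres_class R [(g, True)]" for g
  let ?a = "x a2" and ?b = "x b2" and ?c = "x c2"
  have x: "x g \<in> carrier (H2 p)" for g
    unfolding x_def H2 by (rule presented_group_carrier)
  have pow: "pres_class R [l] [^]\<^bsub>H2 p\<^esub> (n::nat) = pres_class R (replicate n l)" for l n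
    unfolding H2 presented_group_pow concat_replicate_single ..
  have xp: "x g [^]\<^bsub>H2 p\<^esub> p = \<one>\<^bsub>H2 p\<^esub>" for g
  proof -
    have "x g [^]\<^bsub>H2 p\<^esub> p = pres_class R []"
      unfolding x_def pow by (rule presented_group_relation) (cases g; simp add: R_def)
    then show ?thesis by (simp add: H2 presented_group_one)
  qed
  have comm: "pres_class R (comm_word g h) =
      inv\<^bsub>H2 p\<^esub> x g \<otimes>\<^bsub>H2 p\<^esub> (inv\<^bsub>H2 p\<^esub> x h \<otimes>\<^bsub>H2 p\<^esub> (x g \<otimes>\<^bsub>H2 p\<^esub> x h))" for g h
    by (simp add: x_def comm_word_def H2 presented_group_letter_inv presented_group_mult)
  have swap: "g \<otimes>\<^bsub>H2 p\<^esub> h = h \<otimes>\<^bsub>H2 p\<^esub> g \<otimes>\<^bsub>H2 p\<^esub> k"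
    if "inv\<^bsub>H2 p\<^esub> g \<otimes>\<^bsub>H2 p\<^esub> (inv\<^bsub>H2 p\<^esub> h \<otimes>\<^bsub>H2 p\<^esub> (g \<otimes>\<^bsub>H2 p\<^esub> h)) = k"
      "g \<in> carrier (H2 p)" "h \<in> carrier (H2 p)" for g h k
    using that by (auto simp: G.m_assoc G.cancel_inv_left)
  have "pres_class R (comm_word a2 b2) = ?c"
    unfolding x_def by (rule presented_group_relation) (simp add: R_def)
  then have ab: "?a \<otimes>\<^bsub>H2 p\<^esub> ?b = ?b \<otimes>\<^bsub>H2 p\<^esub> ?a \<otimes>\<^bsub>H2 p\<^esub> ?c"
    unfolding comm using x by (intro swap)
  have "pres_class R (comm_word a2 c2) = \<one>\<^bsub>H2 p\<^esub>"
    unfolding H2 presented_group_one by (rule presented_group_relation) (simp add: R_def)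
  then have ac: "?a \<otimes>\<^bsub>H2 p\<^esub> ?c = ?c \<otimes>\<^bsub>H2 p\<^esub> ?a"
    unfolding comm using x swap[of ?a ?c "\<one>\<^bsub>H2 p\<^esub>"] by simp
  have "pres_class R (comm_word b2 c2) = \<one>\<^bsub>H2 p\<^esub>"
    unfolding H2 presented_group_one by (rule presented_group_relation) (simp add: R_def)
  then have bc: "?b \<otimes>\<^bsub>H2 p\<^esub> ?c = ?c \<otimes>\<^bsub>H2 p\<^esub> ?b"
    unfolding comm using x swap[of ?b ?c "\<one>\<^bsub>H2 p\<^esub>"] by simp
  let ?bi = "inv\<^bsub>H2 p\<^esub> ?b"
  have emp: "generate (H2 p) {} = {\<one>\<^bsub>H2 p\<^esub>}"
    using G.generate_empty .
  have c: "finite (generate (H2 p) {?c}) \<and> card (generate (H2 p) {?c}) dvd p"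
    using G.card_generate_insert[of "{}" ?c p] x p xp emp by auto
  have conj_c: "?a \<otimes>\<^bsub>H2 p\<^esub> ?c \<otimes>\<^bsub>H2 p\<^esub> inv\<^bsub>H2 p\<^esub> ?a = ?c"
    unfolding ac using x by (simp add: G.m_assoc)
  have "finite (generate (H2 p) {?a, ?c}) \<and>
      card (generate (H2 p) {?a, ?c}) dvd p * card (generate (H2 p) {?c})"
    using x conj_c xp c p
    by (intro conjI G.card_generate_insert[where S = "{?c}" and g = ?a]) (auto intro: generate.one generate.incl)
  with c have a: "finite (generate (H2 p) {?a, ?c}) \<and> card (generate (H2 p) {?a, ?c}) dvd p * p"
    by (meson dvd_refl dvd_trans mult_dvd_mono)
  have conj_c': "?bi \<otimes>\<^bsub>H2 p\<^esub> ?c \<otimes>\<^bsub>H2 p\<^esub> inv\<^bsub>H2 p\<^esub> ?bi = ?c"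
    using x bc[symmetric] by (simp add: G.m_assoc G.cancel_inv_left)
  have conj_a: "?bi \<otimes>\<^bsub>H2 p\<^esub> ?a \<otimes>\<^bsub>H2 p\<^esub> inv\<^bsub>H2 p\<^esub> ?bi = ?a \<otimes>\<^bsub>H2 p\<^esub> ?c"
    using x ab by (simp add: G.m_assoc G.cancel_inv_left)
  have "?a \<otimes>\<^bsub>H2 p\<^esub> ?c \<in> generate (H2 p) {?a, ?c}"
    by (intro generate.eng) (auto intro: generate.incl)
  moreover have "?bi [^]\<^bsub>H2 p\<^esub> p = \<one>\<^bsub>H2 p\<^esub>"
    using xp x by (simp add: G.nat_pow_inv)
  ultimately have "finite (generate (H2 p) {?bi, ?a, ?c}) \<and>
      card (generate (H2 p) {?bi, ?a, ?c}) dvd p * card (generate (H2 p) {?a, ?c})"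
    using x conj_c' conj_a a p
    by (intro conjI G.card_generate_insert[where S = "{?a, ?c}" and g = ?bi]) (auto intro: generate.one generate.incl)
  with a have "finite (generate (H2 p) {?bi, ?a, ?c}) \<and>
      card (generate (H2 p) {?bi, ?a, ?c}) dvd p * (p * p)"
    by (meson dvd_refl dvd_trans mult_dvd_mono)
  moreover have "generate (H2 p) {?bi, ?a, ?c} = carrier (H2 p)"
  proof -
    have sub: "subgroup (generate (H2 p) {?bi, ?a, ?c}) (H2 p)"
      using x by (intro G.generate_is_subgroup) auto
    have "?bi \<in> generate (H2 p) {?bi, ?a, ?c}" "?a \<in> generate (H2 p) {?bi, ?a, ?c}"
      "?c \<in> generate (H2 p) {?bi, ?a, ?c}"
      by (auto intro: generate.incl)
    then have "x g \<in> generate (H2 p) {?bi, ?a, ?c}" for g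
      using subgroup.m_inv_closed[OF sub, of ?bi] x by (cases g) auto
    then show ?thesis
      using sub unfolding H2 x_def by (intro presented_group_generated) auto
  qed
  ultimately show "finite (carrier (H2 p))" "card (carrier (H2 p)) dvd p ^ 3"
    by (auto simp: power3_eq_cube mult.assoc)
qed

section \<open>Stabilizers and products of sets\<close>

lemma (in group) subgroup_right_stab:
  assumes "T \<subseteq> carrier G"
  shows "subgroup (right_stab G T) G"
proof (rule subgroupI)
  fix a assume "a \<in> right_stab G T"
  then have a: "a \<in> carrier G" "T #> a = T" by (auto simp: right_stab_def)
  have "T #> inv a = T #> a #> inv a" using a by simp
  also have "\<dots> = T" using a(1) assms by (simp add: coset_mult_assoc)
  finally show "inv a \<in> right_stab G T" using a by (simp add: right_stab_def)
next
  fix a b assume "a \<in> right_stab G T" "b \<in> right_stab G T"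
  then have ab: "a \<in> carrier G" "T #> a = T" "b \<in> carrier G" "T #> b = T"
    by (auto simp: right_stab_def)
  then have "T #> (a \<otimes> b) = T"
    using coset_mult_assoc[OF assms ab(1,3)] by simp
  with ab(1,3) show "a \<otimes> b \<in> right_stab G T"
    by (simp add: right_stab_def)
qed (use assms in \<open>auto simp: right_stab_def intro!: exI[of _ \<one>]\<close>)

lemma (in group) right_stab_l_coset:
  assumes K: "subgroup K G" and x: "x \<in> carrier G"
  shows "right_stab G (x <# K) = K"
proof
  show "K \<subseteq> right_stab G (x <# K)"
  proof
    fix k assume k: "k \<in> K"
    then have "k \<in> carrier G" using subgroup.mem_carrier[OF K] by blast
    moreover have "(x <# K) #> k = x <# (K #> k)"
      using subgroup.subset[OF K] x calculation
      by (simp add: l_coset_eq_set_mult r_coset_eq_set_mult set_mult_assoc)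
    ultimately show "k \<in> right_stab G (x <# K)"
      using coset_join3 k K by (simp add: right_stab_def coset_join2)
  qed
  show "right_stab G (x <# K) \<subseteq> K"
  proof
    fix h assume "h \<in> right_stab G (x <# K)"
    then have h: "h \<in> carrier G" "(x <# K) #> h = x <# K" by (auto simp: right_stab_def)
    have "x \<otimes> \<one> \<otimes> h \<in> (x <# K) #> h"
      using subgroup.one_closed[OF K] unfolding r_coset_def l_coset_def by blast
    then have "x \<otimes> h \<in> x <# K" using h x by simp
    then obtain k where "k \<in> K" "x \<otimes> h = x \<otimes> k" unfolding l_coset_def by blast
    then show "h \<in> K" using h x subgroup.mem_carrier[OF K] by simp
  qed
qed

lemma (in group) card_l_coset:
  assumes "K \<subseteq> carrier G" "x \<in> carrier G"
  shows "card (x <# K) = card K"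
proof -
  have "x <# K = (\<otimes>) x ` K" by (auto simp: l_coset_def)
  moreover have "inj_on ((\<otimes>) x) K" using assms by (auto intro!: inj_onI simp: subset_iff)
  ultimately show ?thesis by (simp add: card_image)
qed

lemma (in group) card_r_coset:
  assumes "K \<subseteq> carrier G" "x \<in> carrier G"
  shows "card (K #> x) = card K"
proof -
  have "K #> x = (\<lambda>k. k \<otimes> x) ` K" by (auto simp: r_coset_def)
  moreover have "inj_on (\<lambda>k. k \<otimes> x) K" using assms by (auto intro!: inj_onI simp: subset_iff)
  ultimately show ?thesis by (simp add: card_image)
qed

lemma (in group) l_coset_right_stab_subset:
  "t \<in> T \<Longrightarrow> t <# right_stab G T \<subseteq> T"
  by (auto simp: l_coset_def right_stab_def r_coset_def)

text \<open>
  The substitution \<open>y \<mapsto> y\<inverse> x\<close> exchanges the two factors in the sum over \<open>y\<close>.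
\<close>

lemma (in group) conv_commute:
  assumes comm: "\<And>x y. x \<in> carrier G \<Longrightarrow> y \<in> carrier G \<Longrightarrow> x \<otimes> y = y \<otimes> x"
  shows "conv G f g = conv G g f"
proof
  fix x
  show "conv G f g x = conv G g f x"
  proof (cases "x \<in> carrier G")
    case True
    have "(\<Sum>y\<in>carrier G. f y * g (inv y \<otimes> x)) = (\<Sum>y\<in>carrier G. g y * f (inv y \<otimes> x))"
    proof (rule sum.reindex_bij_witness[where i = "\<lambda>y. inv y \<otimes> x" and j = "\<lambda>y. inv y \<otimes> x"])
      fix y assume y: "y \<in> carrier G"
      show 1: "inv (inv y \<otimes> x) \<otimes> x = y"
        using y True comm[of "inv x" "y"] by (simp add: inv_mult_group m_assoc cancel_inv_left)
      show 2: "inv (inv y \<otimes> x) \<otimes> x = y" by (rule 1)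
      show "g (inv y \<otimes> x) * f (inv (inv y \<otimes> x) \<otimes> x) = f y * g (inv y \<otimes> x)"
        unfolding 1 by simp
    qed (use True in auto)
    with True show ?thesis by (simp add: conv_def)
  qed (simp add: conv_def)
qed

section \<open>Basic sets of an S-ring\<close>

text \<open>
  An S-ring \<open>A\<close> together with its partition \<open>P\<close>.  Its structure is studied through the A-sets below, the
  sets \<open>X\<close> whose sum lies in \<open>A\<close>: they are the unions of basic sets, and they are closed under products.
\<close>

locale schur_partition = group H for H :: "('a, 'm) monoid_scheme" (structure) +
  fixes A :: "('a \<Rightarrow> rat) set" and P :: "'a set set"
  assumes fin: "finite (carrier H)"
    and subalg: "group_subalgebra H A"
    and basic: "basic_partition H A P"
begin

definition A_set :: "'a set \<Rightarrow> bool"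
  where "A_set X \<longleftrightarrow> X \<subseteq> carrier H \<and> underline X \<in> A"

lemma partition: "partition_on (carrier H) P"
  and one_basic: "{\<one>} \<in> P"
  and inv_basic: "T \<in> P \<Longrightarrow> set_inv T \<in> P"
  and span: "rat_fun.span (underline ` P) = A"
  using basic by (auto simp: basic_partition_def)

lemma basic_carrier: "T \<in> P \<Longrightarrow> T \<subseteq> carrier H"
  and basic_nonempty: "T \<in> P \<Longrightarrow> T \<noteq> {}"
  and basic_finite: "T \<in> P \<Longrightarrow> finite T"
  using partition fin by (auto simp: partition_on_def intro: finite_subset)

lemma basic_unique: "T \<in> P \<Longrightarrow> S \<in> P \<Longrightarrow> x \<in> T \<Longrightarrow> x \<in> S \<Longrightarrow> T = S"
  using partition by (auto simp: partition_on_def disjoint_def)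

lemma basic_exists: "x \<in> carrier H \<Longrightarrow> \<exists>T\<in>P. x \<in> T"
  using partition by (auto simp: partition_on_def)

lemma finite_basic: "finite P"
  using fin partition by (metis finite_elements)

lemma A_set_basic: "T \<in> P \<Longrightarrow> A_set T"
  using span by (auto simp: A_set_def basic_carrier intro: rat_fun.span_base)

lemma A_set_subset: "A_set X \<Longrightarrow> T \<in> P \<Longrightarrow> x \<in> T \<Longrightarrow> x \<in> X \<Longrightarrow> T \<subseteq> X"
proof
  fix y assume "A_set X" "T \<in> P" "x \<in> T" "x \<in> X" "y \<in> T"
  then have "underline X x = underline X y"
    using span partition by (intro span_underline_const[of "carrier H" P]) (auto simp: A_set_def)
  with \<open>x \<in> X\<close> show "y \<in> X" by (auto simp: underline_def indicator_def split: if_splits)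
qed

lemma A_setI:
  assumes X: "X \<subseteq> carrier H" and blocks: "\<And>T x. T \<in> P \<Longrightarrow> x \<in> T \<Longrightarrow> x \<in> X \<Longrightarrow> T \<subseteq> X"
  shows "A_set X"
proof -
  have un: "underline (\<Union>F) \<in> A" if "finite F" "F \<subseteq> P" for F
    using that
  proof (induction F)
    case empty
    have "underline {} = (0 :: 'a \<Rightarrow> rat)" by (auto simp: underline_def fun_eq_iff)
    then show ?case using span rat_fun.span_zero[of "underline ` P"] by (simp only: Union_empty)
  next
    case (insert T F)
    then have "underline (\<Union>(insert T F)) = underline T + underline (\<Union>F)"
      using basic_unique by (fastforce simp: underline_def fun_eq_iff indicator_def)
    moreover have "underline T \<in> A" "underline (\<Union>F) \<in> A"
      using insert A_set_basic by (auto simp: A_set_def)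
    then have "underline T + underline (\<Union>F) \<in> A"
      unfolding span[symmetric] by (rule rat_fun.span_add)
    ultimately show ?case by (simp only:)
  qed
  have "X \<subseteq> \<Union>{T \<in> P. T \<subseteq> X}"
  proof
    fix x assume x: "x \<in> X"
    with X obtain T where "T \<in> P" "x \<in> T" using basic_exists by blast
    with x blocks show "x \<in> \<Union>{T \<in> P. T \<subseteq> X}" by auto
  qed
  then have "X = \<Union>{T \<in> P. T \<subseteq> X}" by auto
  then show ?thesis
    using X un[of "{T \<in> P. T \<subseteq> X}"] finite_basic by (auto simp: A_set_def)
qed

lemma A_set_eq_basic: "A_set X \<Longrightarrow> X \<noteq> {} \<Longrightarrow> X \<subseteq> T \<Longrightarrow> T \<in> P \<Longrightarrow> X = T"
  using A_set_subset by blast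

text \<open>
  All coefficients of a product of two such sums are non-negative, so the support of the product is the
  product of the sets; and as an element of \<open>A\<close> the product is constant on each basic set.
\<close>

lemma A_set_mult:
  assumes X: "A_set X" and Y: "A_set Y"
  shows "A_set (X <#> Y)"
proof (rule A_setI)
  have sub: "X \<subseteq> carrier H" "Y \<subseteq> carrier H" using X Y by (auto simp: A_set_def)
  show "X <#> Y \<subseteq> carrier H" using sub by (rule set_mult_closed)
  define f where "f = conv H (underline X) (underline Y)"
  have f: "f \<in> rat_fun.span (underline ` P)"
    using subalg X Y span by (auto simp: f_def group_subalgebra_def A_set_def)
  have supp: "x \<in> X <#> Y \<longleftrightarrow> f x \<noteq> 0" if x: "x \<in> carrier H" for x
  proof -
    have "f x = 0 \<longleftrightarrow> (\<forall>y\<in>carrier H. underline X y * underline Y (inv y \<otimes> x) = (0::rat))"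
      unfolding f_def conv_def if_P[OF x]
      by (rule sum_nonneg_eq_0_iff[OF fin]) (simp add: underline_def)
    also have "\<dots> \<longleftrightarrow> x \<notin> X <#> Y"
    proof
      assume *: "\<forall>y\<in>carrier H. underline X y * underline Y (inv y \<otimes> x) = (0::rat)"
      show "x \<notin> X <#> Y"
      proof
        assume "x \<in> X <#> Y"
        then obtain a b where ab: "a \<in> X" "b \<in> Y" "x = a \<otimes> b" unfolding set_mult_def by blast
        then have "inv a \<otimes> x = b" using sub by (simp add: cancel_inv_left subset_iff)
        with * ab sub show False by (auto simp: underline_def dest!: bspec[of _ _ a])
      qed
    next
      assume *: "x \<notin> X <#> Y"
      show "\<forall>y\<in>carrier H. underline X y * underline Y (inv y \<otimes> x) = (0::rat)"
      proof
        fix y assume y: "y \<in> carrier H"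
        have "y \<otimes> (inv y \<otimes> x) = x" using x y by (simp add: cancel_inv_left)
        with * have "\<not> (y \<in> X \<and> inv y \<otimes> x \<in> Y)" unfolding set_mult_def by force
        then show "underline X y * underline Y (inv y \<otimes> x) = (0::rat)"
          by (auto simp: underline_def)
      qed
    qed
    finally show ?thesis by blast
  qed
  fix T x assume T: "T \<in> P" "x \<in> T" "x \<in> X <#> Y"
  show "T \<subseteq> X <#> Y"
  proof
    fix y assume y: "y \<in> T"
    have c: "x \<in> carrier H" "y \<in> carrier H" using T y basic_carrier by blast+
    have "f x = f y" by (rule span_underline_const[OF partition f T(1,2) y])
    then show "y \<in> X <#> Y"
      using T(3) unfolding supp[OF c(1)] supp[OF c(2)] by simp
  qed
qed

lemma mem_set_inv: "x \<in> X \<Longrightarrow> inv x \<in> set_inv X"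
  unfolding SET_INV_def by blast

section \<open>Thin radical and thin residue\<close>

text \<open>
  The thin radical.
\<close>

definition thin :: "'a set"
  where "thin = {h \<in> carrier H. {h} \<in> P}"

text \<open>
  Translating by a thin element maps A-sets to A-sets, and so does translating back; so a basic subset of
  \<open>T h\<close> comes from a basic subset of \<open>T\<close>.
\<close>

lemma thin_r_coset:
  assumes h: "h \<in> thin" and T: "T \<in> P"
  shows "T #> h \<in> P"
proof -
  have hc: "h \<in> carrier H" "{h} \<in> P" using h by (auto simp: thin_def)
  have hi: "{inv h} \<in> P" using inv_basic[OF hc(2)] by (simp add: SET_INV_def)
  have shift: "A_set (X #> k)" if "A_set X" "{k} \<in> P" for X k
    using A_set_mult[OF that(1) A_set_basic[OF that(2)]] by (simp add: r_coset_eq_set_mult)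
  obtain t where t: "t \<in> T" using basic_nonempty[OF T] by blast
  then have tc: "t \<otimes> h \<in> carrier H" using basic_carrier[OF T] hc by auto
  then obtain S where S: "S \<in> P" "t \<otimes> h \<in> S" using basic_exists by blast
  have "t \<otimes> h \<in> T #> h" using t by (auto simp: r_coset_def)
  then have STh: "S \<subseteq> T #> h" using A_set_subset[OF shift[OF A_set_basic[OF T] hc(2)] S] by blast
  have "S #> inv h \<subseteq> T #> h #> inv h"
    using STh by (auto simp: r_coset_def)
  then have "S #> inv h \<subseteq> T"
    using hc basic_carrier[OF T] by (simp add: coset_mult_assoc)
  moreover have "S #> inv h \<noteq> {}" using S by (auto simp: r_coset_def)
  ultimately have "S #> inv h = T"
    using A_set_eq_basic[OF shift[OF A_set_basic[OF S(1)] hi] _ _ T] by blast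
  then have "T #> h = S #> inv h #> h" by simp
  also have "\<dots> = S" using hc(1) basic_carrier[OF S(1)] by (simp add: coset_mult_assoc)
  finally have "T #> h = S" .
  with S show ?thesis by simp
qed

lemma thin_subgroup: "subgroup thin H"
proof (rule finite_submonoid_is_subgroup[OF fin])
  show "thin \<subseteq> carrier H" "\<one> \<in> thin" using one_basic by (auto simp: thin_def)
  fix x y assume xy: "x \<in> thin" "y \<in> thin"
  then have "{x} #> y \<in> P" by (intro thin_r_coset) (auto simp: thin_def)
  with xy show "x \<otimes> y \<in> thin" by (auto simp: thin_def r_coset_def)
qed

lemma A_set_if_subset_thin:
  assumes X: "X \<subseteq> thin"
  shows "A_set X"
proof (rule A_setI)
  show "X \<subseteq> carrier H" using X by (auto simp: thin_def)
  fix T x assume T: "T \<in> P" "x \<in> T" "x \<in> X"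
  then have "{x} \<in> P" using X by (auto simp: thin_def)
  with T have "T = {x}" by (intro basic_unique[of T "{x}" x]) simp_all
  with T show "T \<subseteq> X" by simp
qed

text \<open>
  The thin residue.
\<close>

definition residue :: "'a set"
  where "residue = generate H (\<Union>T\<in>P. set_inv T <#> T)"

lemma residue_gens_carrier: "(\<Union>T\<in>P. set_inv T <#> T) \<subseteq> carrier H"
  using inv_basic basic_carrier by (intro UN_least set_mult_closed) auto

lemma residue_subgroup: "subgroup residue H"
  unfolding residue_def by (rule generate_is_subgroup[OF residue_gens_carrier])

lemma residueI: "T \<in> P \<Longrightarrow> x \<in> T \<Longrightarrow> y \<in> T \<Longrightarrow> inv x \<otimes> y \<in> residue"
  unfolding residue_def using mem_set_inv
  by (intro generate.incl) (auto simp: set_mult_def)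

text \<open>
  Induction along the generation: a basic set meeting a product of two basic sets is contained in it.
\<close>

lemma residue_A_set: "A_set residue"
proof (rule A_setI)
  show "residue \<subseteq> carrier H" by (rule subgroup.subset[OF residue_subgroup])
  fix T x assume "T \<in> P" "x \<in> T" "x \<in> residue"
  from this(3,1,2) show "T \<subseteq> residue" unfolding residue_def
  proof (induction arbitrary: T rule: generate.induct)
    case one
    then have "T = {\<one>}" using basic_unique one_basic by blast
    then show ?case by (auto intro: generate.one)
  next
    case (incl h)
    then obtain S where S: "S \<in> P" "h \<in> set_inv S <#> S" by blast
    have "T \<subseteq> set_inv S <#> S"
      by (rule A_set_subset[OF A_set_mult[OF A_set_basic A_set_basic] incl.prems S(2)])
         (use S inv_basic in auto)
    also have "\<dots> \<subseteq> generate H (\<Union>T\<in>P. set_inv T <#> T)"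
      using S by (auto intro: generate.incl)
    finally show ?case .
  next
    case (inv h)
    then have h: "h \<in> carrier H" using residue_gens_carrier by blast
    obtain S where S: "S \<in> P" "h \<in> set_inv S <#> S" using inv by blast
    have "inv (inv h) \<in> set_inv T" using inv.prems by (intro mem_set_inv) simp
    then have "h \<in> set_inv T" using h by simp
    then have "set_inv T \<subseteq> set_inv S <#> S"
      by (intro A_set_subset[OF A_set_mult[OF A_set_basic A_set_basic] _ _ S(2)])
         (use S inv_basic inv.prems in auto)
    then have "set_inv T \<subseteq> generate H (\<Union>T\<in>P. set_inv T <#> T)"
      using S by (auto intro: generate.incl)
    then have "inv y \<in> generate H (\<Union>T\<in>P. set_inv T <#> T)" if "y \<in> T" for y
      using that mem_set_inv by blast
    then have "inv (inv y) \<in> generate H (\<Union>T\<in>P. set_inv T <#> T)" if "y \<in> T" for y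
      using that residue_gens_carrier generate_m_inv_closed by blast
    then show ?case using basic_carrier[OF inv.prems(1)] by (auto simp: subset_iff)
  next
    case (eng h1 h2)
    have hc: "h1 \<in> carrier H" "h2 \<in> carrier H"
      using eng.hyps residue_gens_carrier generate_in_carrier by blast+
    obtain S1 S2 where S: "S1 \<in> P" "h1 \<in> S1" "S2 \<in> P" "h2 \<in> S2"
      using basic_exists hc by meson
    have "T \<subseteq> S1 <#> S2"
      by (rule A_set_subset[OF A_set_mult[OF A_set_basic A_set_basic] eng.prems])
         (use S in \<open>auto simp: set_mult_def\<close>)
    also have "\<dots> \<subseteq> generate H (\<Union>T\<in>P. set_inv T <#> T)"
      using eng.IH S by (auto simp: set_mult_def intro!: generate.eng)
    finally show ?case .
  qed
qed

text \<open>
  The elements \<open>x\<close> for which \<open>xK = Kx\<close> is an A-set are closed under products, because then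
  \<open>xK yK = xy K\<close>.  So they form a subgroup, and a maximal subgroup together with one more element
  exhausts \<open>H\<close>.
\<close>

lemma cosets_A_sets_propagate:
  assumes p: "prime p" and ord: "order H = p ^ Suc n" and L: "card L = p ^ n"
    and K: "subgroup K H"
    and good: "\<And>x. x \<in> insert t L \<Longrightarrow> x \<in> carrier H \<and> x <# K = K #> x \<and> A_set (x <# K)"
    and t: "t \<notin> L" and x: "x \<in> carrier H"
  shows "A_set (x <# K)"
proof -
  note Kc = subgroup.subset[OF K]
  define X where "X = {x \<in> carrier H. x <# K = K #> x \<and> A_set (x <# K)}"
  have ins: "insert t L \<subseteq> X"
  proof
    fix x assume "x \<in> insert t L"
    from good[OF this] show "x \<in> X" unfolding X_def by blast
  qed
  have "L \<noteq> {}" using L p by auto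
  have prod: "x \<otimes> y <# K = x <# K <#> (y <# K)" "K #> x \<otimes> y = x \<otimes> y <# K"
    if "x \<in> X" "y \<in> X" for x y
  proof -
    have c: "x \<in> carrier H" "y \<in> carrier H" "{x} <#> K = K <#> {x}" "{y} <#> K = K <#> {y}"
      using that by (auto simp: X_def l_coset_eq_set_mult r_coset_eq_set_mult)
    have xy: "{x \<otimes> y} = {x} <#> {y}" by (auto simp: set_mult_def)
    have KK: "K <#> K = K" by (rule subgroup_mult_id[OF K])
    have "{x} <#> K <#> ({y} <#> K) = {x} <#> (K <#> {y}) <#> K"
      using c(1,2) Kc by (simp add: set_mult_assoc set_mult_closed)
    also have "\<dots> = {x} <#> ({y} <#> K) <#> K"
      by (simp only: c(4))
    also have "\<dots> = {x} <#> {y} <#> (K <#> K)"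
      using c(1,2) Kc by (simp add: set_mult_assoc set_mult_closed)
    finally show "x \<otimes> y <# K = x <# K <#> (y <# K)"
      by (simp add: l_coset_eq_set_mult xy KK)
    have "K <#> ({x} <#> {y}) = (K <#> {x}) <#> {y}"
      using c(1,2) Kc by (simp add: set_mult_assoc)
    also have "\<dots> = ({x} <#> K) <#> {y}" by (simp only: c(3))
    also have "\<dots> = {x} <#> (K <#> {y})"
      using c(1,2) Kc by (simp add: set_mult_assoc)
    also have "\<dots> = {x} <#> ({y} <#> K)" by (simp only: c(4))
    also have "\<dots> = ({x} <#> {y}) <#> K"
      using c(1,2) Kc by (simp add: set_mult_assoc)
    finally show "K #> x \<otimes> y = x \<otimes> y <# K"
      by (simp add: l_coset_eq_set_mult r_coset_eq_set_mult xy)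
  qed
  have "subgroup X H"
  proof (rule finite_submonoid_is_subgroup[OF fin])
    show "X \<subseteq> carrier H" by (auto simp: X_def)
    show closed: "x \<otimes> y \<in> X" if "x \<in> X" "y \<in> X" for x y
      using that prod[OF that] A_set_mult by (auto simp: X_def)
    obtain l where l: "l \<in> X" using ins by blast
    \<comment> \<open>The identity is a positive power of any member.\<close>
    have "l [^] Suc n \<in> X" for n
    proof (induction n)
      case 0
      show ?case using l by (auto simp: X_def)
    next
      case (Suc n)
      from closed[OF Suc l] show ?case by simp
    qed
    then have "l [^] order H \<in> X"
      using p ord by (metis gr0_conv_Suc prime_gt_0_nat zero_less_power)
    then show "\<one> \<in> X" using l pow_order_eq_1 by (auto simp: X_def)
  qed
  then have "X = carrier H"
    using ins t by (intro maximal_subgroup[OF p ord L]) auto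
  then show ?thesis using x by (auto simp: X_def)
qed

end

section \<open>The order of the thin residue\<close>

text \<open>
  The condition \<open>two_stabs\<close> forbids that all outer basic sets are cosets of one and the same subgroup,
  which is how every degenerate case below is excluded.
\<close>

locale thin_residue_setting = schur_partition +
  fixes p :: nat
  assumes prime_p: "prime p"
    and order_H: "order H = p ^ 3"
    and nonabelian: "\<exists>x\<in>carrier H. \<exists>y\<in>carrier H. x \<otimes> y \<noteq> y \<otimes> x"
    and p_sizes: "T \<in> P \<Longrightarrow> \<exists>k. card T = p ^ k"
    and outside_size: "T \<in> P \<Longrightarrow> \<not> T \<subseteq> residue \<Longrightarrow> card T = p"
    and two_stabs: "\<exists>S\<in>P. \<exists>S'\<in>P. \<not> S \<subseteq> residue \<and> \<not> S' \<subseteq> residue \<and>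
      right_stab H S \<noteq> right_stab H S'"
begin

lemma p_gt_1: "1 < p" by (rule prime_gt_1_nat[OF prime_p])

lemma residue_carrier: "residue \<subseteq> carrier H"
  by (rule subgroup.subset[OF residue_subgroup])

lemma outside_disjoint: "T \<in> P \<Longrightarrow> \<not> T \<subseteq> residue \<Longrightarrow> x \<in> T \<Longrightarrow> x \<notin> residue"
  using A_set_subset[OF residue_A_set] by blast

lemma subset_coset_of_residue: "T \<in> P \<Longrightarrow> t \<in> T \<Longrightarrow> T \<subseteq> t <# residue"
proof
  fix x assume T: "T \<in> P" "t \<in> T" "x \<in> T"
  then have "t \<in> carrier H" "x \<in> carrier H" using basic_carrier by blast+
  then have "x = t \<otimes> (inv t \<otimes> x)" by (simp add: cancel_inv_left)
  then show "x \<in> t <# residue" using residueI[OF T] unfolding l_coset_def by blast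
qed

lemma card_eq_p_power:
  assumes "subgroup X H"
  shows "\<exists>i\<le>3. card X = p ^ i"
  using card_subgroup_dvd[OF assms subgroup_self subgroup.subset[OF assms]] order_H
    divides_primepow_nat[OF prime_p] by (auto simp: order_def)

text \<open>
  An outer basic set has the size of a coset of \<open>K\<close>, so it would be one, with stabilizer \<open>K\<close>.
\<close>

lemma cosets_not_all_A_sets:
  assumes K: "subgroup K H" "card K = p"
    and cosets: "\<And>x. x \<in> carrier H \<Longrightarrow> A_set (x <# K)"
  shows False
proof -
  have "right_stab H T = K" if T: "T \<in> P" "\<not> T \<subseteq> residue" for T
  proof -
    obtain t where t: "t \<in> T" using basic_nonempty[OF T(1)] by blast
    then have tc: "t \<in> carrier H" using basic_carrier[OF T(1)] by blast
    have "t \<in> t <# K" using subgroup.one_closed[OF K(1)] tc by (force simp: l_coset_def)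
    then have "T \<subseteq> t <# K" using A_set_subset[OF cosets[OF tc] T(1) t] by blast
    moreover have "card (t <# K) = card T"
      using outside_size[OF T] K tc subgroup.subset[OF K(1)] by (simp add: card_l_coset)
    moreover have "finite (t <# K)"
      using finite_subset[OF l_coset_subset_G fin] tc subgroup.subset[OF K(1)] by blast
    ultimately have "T = t <# K" using card_subset_eq by metis
    then show ?thesis using right_stab_l_coset[OF K(1) tc] by simp
  qed
  with two_stabs show False by blast
qed

text \<open>
  A residue of order \<open>p\<close> is excluded since the outer basic sets would be its cosets, all with the same
  stabilizer; smaller orders leave no room for basic sets of size \<open>p\<close> in a coset.
\<close>

lemma card_residue: "card residue = p\<^sup>2"
proof -
  obtain S where S: "S \<in> P" "\<not> S \<subseteq> residue" using two_stabs by blast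
  obtain s where s: "s \<in> S" using basic_nonempty[OF S(1)] by blast
  then have sc: "s \<in> carrier H" using basic_carrier[OF S(1)] by blast
  obtain i where i: "i \<le> 3" "card residue = p ^ i"
    using card_eq_p_power[OF residue_subgroup] by blast
  have fr: "finite residue" using finite_subset[OF residue_carrier fin] .
  have "p \<le> card residue"
  proof -
    have "card S \<le> card (s <# residue)"
      using finite_subset[OF l_coset_subset_G fin] sc residue_carrier
      by (intro card_mono subset_coset_of_residue[OF S(1) s]) blast
    then show ?thesis using outside_size[OF S] card_l_coset[OF residue_carrier sc] by simp
  qed
  then have "i \<noteq> 0" using i p_gt_1 by (intro notI) simp
  moreover have "i \<noteq> 3"
  proof
    assume "i = 3"
    then have "residue = carrier H"
      using i order_H card_subset_eq[OF fin residue_carrier] by (simp add: order_def)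
    then show False using S basic_carrier by blast
  qed
  moreover have "i \<noteq> 1"
  proof
    assume "i = 1"
    then have cr: "card residue = p" using i by simp
    have "right_stab H T = residue" if T: "T \<in> P" "\<not> T \<subseteq> residue" for T
    proof -
      obtain t where t: "t \<in> T" using basic_nonempty[OF T(1)] by blast
      then have tc: "t \<in> carrier H" using basic_carrier[OF T(1)] by blast
      have "finite (t <# residue)"
        using finite_subset[OF l_coset_subset_G fin] tc residue_carrier by blast
      then have "T = t <# residue"
        using subset_coset_of_residue[OF T(1) t] outside_size[OF T] cr
          card_l_coset[OF residue_carrier tc] by (intro card_subset_eq) simp_all
      then show ?thesis using right_stab_l_coset[OF residue_subgroup tc] by simp
    qed
    with two_stabs show False by blast
  qed
  ultimately have "i = 2" using i(1) by linarith
  with i show ?thesis by simp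
qed

lemma residue_commute: "x \<in> residue \<Longrightarrow> y \<in> residue \<Longrightarrow> x \<otimes> y = y \<otimes> x"
  using group.order_dvd_prime_square_imp_comm[OF subgroup.subgroup_is_group[OF residue_subgroup is_group] prime_p]
    card_residue finite_subset[OF residue_carrier fin] by (simp add: order_def)

lemma no_propagating_subgroup:
  assumes K: "subgroup K H" "card K = p"
    and good: "\<And>x. x \<in> insert t residue \<Longrightarrow> x <# K = K #> x \<and> A_set (x <# K)"
    and t: "t \<in> carrier H" "t \<notin> residue"
  shows False
proof (rule cosets_not_all_A_sets[OF K])
  have ord: "order H = p ^ Suc 2" using order_H by simp
  have good': "x \<in> carrier H \<and> x <# K = K #> x \<and> A_set (x <# K)" if "x \<in> insert t residue" for x
    using good[OF that] that t(1) residue_carrier by blast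
  show "A_set (x <# K)" if "x \<in> carrier H" for x
    by (rule cosets_A_sets_propagate[OF prime_p ord card_residue K(1) good' t(2) that])
qed

section \<open>The thin residue is thin\<close>

lemma thin_subset_residue: "thin \<subseteq> residue"
proof
  fix h assume "h \<in> thin"
  then show "h \<in> residue" using outside_size[of "{h}"] p_gt_1 by (auto simp: thin_def)
qed

text \<open>
  The sizes of the basic sets add up to \<open>p\<^sup>3\<close>, and all of them except the singletons are divisible by \<open>p\<close>.
\<close>

lemma p_dvd_card_thin: "p dvd card thin"
proof -
  have "card (carrier H) = (\<Sum>T\<in>P. card T)"
    using partition basic_finite by (subst card_Union_disjoint[symmetric])
      (auto simp: partition_on_def disjoint_def pairwise_def disjnt_def)
  also have "\<dots> = (\<Sum>T\<in>{T \<in> P. card T = 1}. card T) + (\<Sum>T\<in>{T \<in> P. card T \<noteq> 1}. card T)"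
    using finite_basic by (subst sum.union_disjoint[symmetric]) (auto intro!: sum.cong)
  also have "(\<Sum>T\<in>{T \<in> P. card T = 1}. card T) = card thin"
  proof -
    have "{T \<in> P. card T = 1} = (\<lambda>h. {h}) ` thin"
      using basic_carrier by (auto simp: thin_def card_1_singleton_iff)
    moreover have "inj_on (\<lambda>h. {h}) thin" by (auto intro: inj_onI)
    ultimately show ?thesis by (simp add: sum.reindex)
  qed
  finally have "p ^ 3 = card thin + (\<Sum>T\<in>{T \<in> P. card T \<noteq> 1}. card T)"
    using order_H by (simp add: order_def)
  moreover have "p dvd (\<Sum>T\<in>{T \<in> P. card T \<noteq> 1}. card T)"
  proof (rule dvd_sum)
    fix T assume "T \<in> {T \<in> P. card T \<noteq> 1}"
    then obtain k where k: "card T = p ^ k" using p_sizes by blast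
    moreover have "k \<noteq> 0" using k \<open>T \<in> {T \<in> P. card T \<noteq> 1}\<close> by (intro notI) simp
    ultimately show "p dvd card T" by simp
  qed
  moreover have "p dvd p ^ 3" by simp
  ultimately show ?thesis
    using dvd_add_left_iff[of p "\<Sum>T\<in>{T \<in> P. card T \<noteq> 1}. card T" "card thin"] by (simp only:)
qed

text \<open>
  The stabilizer \<open>M\<close> has order dividing \<open>p\<^sup>3\<close> and at most \<open>p\<close>, since \<open>tM \<subseteq> T\<close>; so \<open>T = tM\<close>.  The last claim
  makes \<open>M\<close> a product of basic sets, and thus an A-set contained in the residue.
\<close>

lemma nontrivial_stab_coset:
  assumes T: "T \<in> P" "\<not> T \<subseteq> residue" and t: "t \<in> T" and M: "right_stab H T \<noteq> {\<one>}"
  shows "card (right_stab H T) = p" "T = t <# right_stab H T"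
    "set_inv T <#> T = right_stab H T"
proof -
  define M where "M = right_stab H T"
  have Ms: "subgroup M H" unfolding M_def by (rule subgroup_right_stab[OF basic_carrier[OF T(1)]])
  note Mc = subgroup.subset[OF Ms]
  have tc: "t \<in> carrier H" using t basic_carrier[OF T(1)] by blast
  have sub: "t <# M \<subseteq> T" unfolding M_def by (rule l_coset_right_stab_subset[OF t])
  then have "card M \<le> p"
    using card_mono[OF basic_finite[OF T(1)] sub] card_l_coset[OF Mc tc] outside_size[OF T] by simp
  moreover obtain i where i: "card M = p ^ i" using card_eq_p_power[OF Ms] by blast
  moreover have "i \<noteq> 0"
  proof
    assume "i = 0"
    then have "card M = 1" using i by simp
    then have "M = {\<one>}" using subgroup.one_closed[OF Ms] by (metis card_1_singletonE singletonD)
    with M show False by (simp add: M_def)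
  qed
  moreover have "i \<le> 1"
  proof (rule ccontr)
    assume "\<not> i \<le> 1"
    then have "p ^ 1 < p ^ i" using p_gt_1 by (intro power_strict_increasing) auto
    with i \<open>card M \<le> p\<close> show False by simp
  qed
  ultimately have cM: "card M = p" by (simp add: le_Suc_eq)
  then show "card (right_stab H T) = p" by (simp add: M_def)
  have eq: "t <# M = T"
    using card_subset_eq[OF basic_finite[OF T(1)] sub] card_l_coset[OF Mc tc] outside_size[OF T] cM by simp
  then show "T = t <# right_stab H T" by (simp add: M_def)
  have "set_inv T <#> T = M"
  proof
    show "set_inv T <#> T \<subseteq> M"
    proof
      fix x assume "x \<in> set_inv T <#> T"
      then obtain a b where ab: "a \<in> T" "b \<in> T" "x = inv a \<otimes> b"
        unfolding set_mult_def SET_INV_def by blast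
      then obtain m n where mn: "m \<in> M" "n \<in> M" "a = t \<otimes> m" "b = t \<otimes> n"
        unfolding eq[symmetric] l_coset_def by blast
      then have "m \<in> carrier H" "n \<in> carrier H" using Mc by blast+
      then have "x = inv m \<otimes> n" using ab mn tc by (simp add: inv_mult_group m_assoc cancel_inv_left)
      then show "x \<in> M" using mn Ms by (simp add: subgroup.m_closed subgroup.m_inv_closed)
    qed
    show "M \<subseteq> set_inv T <#> T"
    proof
      fix m assume m: "m \<in> M"
      then have "m = inv t \<otimes> (t \<otimes> m)" using Mc tc by (simp add: cancel_inv_left subset_iff)
      moreover have "t \<otimes> m \<in> T" using sub m by (auto simp: l_coset_def)
      ultimately show "m \<in> set_inv T <#> T"
        using mem_set_inv[OF t] unfolding set_mult_def by blast
    qed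
  qed
  then show "set_inv T <#> T = right_stab H T" by (simp add: M_def)
qed

text \<open>
  Let \<open>T\<close> be the basic set of \<open>x\<close>; its size is a power of \<open>p\<close> between \<open>p\<close> and \<open>p\<^sup>2 - p\<close>, hence \<open>p\<close>.  If the thin radical
  did not stabilize \<open>T\<close>, the \<open>p\<close> translates of \<open>T\<close> by thin elements would be disjoint, and \<open>p\<^sup>2\<close> elements
  do not fit into the complement of the thin radical in the residue.
\<close>

lemma small_thin_cosets_basic:
  assumes thin: "card thin = p" and x: "x \<in> residue" "x \<notin> thin"
  shows "x <# thin \<in> P"
proof -
  have xc: "x \<in> carrier H" using x residue_carrier by blast
  then obtain T where T: "T \<in> P" "x \<in> T" using basic_exists by blast
  note thc = subgroup.subset[OF thin_subgroup]
  have Tres: "T \<subseteq> residue" by (rule A_set_subset[OF residue_A_set T x(1)])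
  have Tthin: "T \<inter> thin = {}"
  proof (rule ccontr)
    assume "T \<inter> thin \<noteq> {}"
    then obtain h where "h \<in> T" "{h} \<in> P" "h \<in> thin" by (auto simp: thin_def)
    then have "T = {h}" using basic_unique[OF T(1)] by blast
    then show False using T x \<open>h \<in> thin\<close> by simp
  qed
  have "finite residue" by (rule finite_subset[OF residue_carrier fin])
  then have "card (residue - thin) = p\<^sup>2 - p"
    using thin card_residue thin_subset_residue by (simp add: card_Diff_subset finite_subset)
  then have bound: "card Y < p\<^sup>2" if "Y \<subseteq> residue - thin" for Y
    using card_mono[OF _ that] \<open>finite residue\<close> p_gt_1 by (simp add: power2_eq_square order_le_less_trans)
  obtain j where j: "card T = p ^ j" using p_sizes[OF T(1)] by blast
  have "j \<noteq> 0"
  proof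
    assume "j = 0"
    then have "T = {x}" using j T(2) by (metis card_1_singletonE power_0 singletonD)
    then show False using T x xc by (simp add: thin_def)
  qed
  moreover have "p ^ j < p\<^sup>2" using bound[of T] Tres Tthin j by auto
  then have "j < 2" using p_gt_1 by simp
  ultimately have cT: "card T = p" using j by (simp add: less_2_cases_iff)
  define M where "M = right_stab H T"
  have Ms: "subgroup M H" unfolding M_def by (rule subgroup_right_stab[OF basic_carrier[OF T(1)]])
  have "thin \<subseteq> M"
  proof (rule ccontr)
    assume "\<not> thin \<subseteq> M"
    then have int: "thin \<inter> M = {\<one>}"
      using subgroup_prime_order_cases[OF thin_subgroup _ Ms] thin prime_p by blast
    have sub: "(\<Union>k\<in>thin. T #> k) \<subseteq> residue - thin"
    proof
      fix y assume "y \<in> (\<Union>k\<in>thin. T #> k)"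
      then obtain k u where k: "k \<in> thin" "u \<in> T" "y = u \<otimes> k" by (auto simp: r_coset_def)
      have c: "u \<in> carrier H" "k \<in> carrier H" using k thc basic_carrier[OF T(1)] by blast+
      have "y \<in> residue"
        using k Tres thin_subset_residue by (auto intro: subgroup.m_closed[OF residue_subgroup])
      moreover have "y \<notin> thin"
      proof
        assume "y \<in> thin"
        then have "y \<otimes> inv k \<in> thin"
          using k thin_subgroup by (simp add: subgroup.m_closed subgroup.m_inv_closed)
        then have "u \<in> thin" using k c by (simp add: m_assoc)
        then show False using k Tthin by blast
      qed
      ultimately show "y \<in> residue - thin" by blast
    qed
    have "card (\<Union>k\<in>thin. T #> k) = (\<Sum>k\<in>thin. card (T #> k))"
    proof (rule card_UN_disjoint)
      show "finite thin" using thin p_gt_1 by (intro card_ge_0_finite) simp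
      show "\<forall>k\<in>thin. finite (T #> k)" using thin_r_coset[OF _ T(1)] basic_finite by blast
      show "\<forall>k\<in>thin. \<forall>l\<in>thin. k \<noteq> l \<longrightarrow> (T #> k) \<inter> (T #> l) = {}"
      proof (intro ballI impI, rule ccontr)
        fix k l assume kl: "k \<in> thin" "l \<in> thin" "k \<noteq> l" "(T #> k) \<inter> (T #> l) \<noteq> {}"
        then have c: "k \<in> carrier H" "l \<in> carrier H" using thc by blast+
        obtain y where "y \<in> T #> k" "y \<in> T #> l" using kl(4) by blast
        then have "T #> k = T #> l"
          using basic_unique[OF thin_r_coset[OF kl(1) T(1)] thin_r_coset[OF kl(2) T(1)]] by simp
        then have "T #> (k \<otimes> inv l) = T"
          using c basic_carrier[OF T(1)] by (intro coset_mult_inv2)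
        then have "k \<otimes> inv l \<in> M" using c by (simp add: M_def right_stab_def)
        moreover have "k \<otimes> inv l \<in> thin"
          using kl thin_subgroup by (simp add: subgroup.m_closed subgroup.m_inv_closed)
        ultimately have "k \<otimes> inv l = \<one>" using int by blast
        then have "k \<otimes> inv l \<otimes> l = l" using c by simp
        then have "k = l" using c by (simp add: m_assoc)
        with kl show False by blast
      qed
    qed
    also have "\<dots> = p * p"
      using thc card_r_coset[OF basic_carrier[OF T(1)]] thin cT by (simp add: subset_iff)
    finally show False using bound[OF sub] by (simp add: power2_eq_square)
  qed
  then have sub: "x <# thin \<subseteq> T"
    using l_coset_right_stab_subset[OF T(2)] by (fastforce simp: M_def l_coset_def)
  have "x <# thin = T"
    using card_subset_eq[OF basic_finite[OF T(1)] sub] card_l_coset[OF thc xc] thin cT by simp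
  with T show ?thesis by simp
qed

lemma residue_coset_commute:
  assumes "K \<subseteq> residue" "x \<in> residue"
  shows "x <# K = K #> x"
proof -
  have "x \<otimes> k = k \<otimes> x" if "k \<in> K" for k using residue_commute assms that by blast
  then show ?thesis by (auto simp: l_coset_def r_coset_def)
qed

text \<open>
  Otherwise the thin radical \<open>K\<close> has order \<open>p\<close>.  The stabilizer of an outer basic set is an A-set of size
  at most \<open>p\<close> containing \<open>1\<close>, so it contains no coset of \<open>K\<close> other than \<open>K\<close>; hence it is trivial or
  equal to \<open>K\<close>, and the second case occurs for some \<open>S = tK\<close>.  The stabilizer of \<open>S\<inverse> = K t\<inverse>\<close> is a
  conjugate of \<open>K\<close>, so it is non-trivial, so it is \<open>K\<close> too, and \<open>S\<inverse> = t\<inverse>K\<close>.  Thus \<open>K t\<inverse> = t\<inverse>K\<close> is an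
  A-set, and the cosets of \<open>K\<close> propagate.
\<close>

lemma thin_eq_residue: "thin = residue"
proof -
  have "card thin dvd p\<^sup>2"
    using card_subgroup_dvd[OF thin_subgroup residue_subgroup thin_subset_residue] card_residue by simp
  then obtain i where i: "i \<le> 2" "card thin = p ^ i"
    using divides_primepow_nat[OF prime_p] by blast
  have "i \<noteq> 0" using i p_dvd_card_thin p_gt_1 by (intro notI) simp
  moreover have "i \<noteq> 1"
  proof
    assume "i = 1"
    then have thin: "card thin = p" using i by simp
    note thc = subgroup.subset[OF thin_subgroup]
    have cosets: "A_set (x <# thin)" if x: "x \<in> residue" for x
    proof (cases "x \<in> thin")
      case True
      then have "x <# thin = thin" using coset_join3 thin_subgroup thc by blast
      then show ?thesis using A_set_if_subset_thin[of thin] by simp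
    next
      case False
      then show ?thesis using small_thin_cosets_basic[OF thin x] A_set_basic by blast
    qed
    have stab_thin: "right_stab H T = thin"
      if T: "T \<in> P" "\<not> T \<subseteq> residue" and M: "right_stab H T \<noteq> {\<one>}" for T
    proof -
      obtain t where t: "t \<in> T" using basic_nonempty[OF T(1)] by blast
      note st = nontrivial_stab_coset[OF T t M]
      define M where "M = right_stab H T"
      have Ms: "subgroup M H" unfolding M_def by (rule subgroup_right_stab[OF basic_carrier[OF T(1)]])
      have MA: "A_set M"
        unfolding M_def st(3)[symmetric] using T(1) inv_basic by (intro A_set_mult A_set_basic)
      have Mr: "M \<subseteq> residue"
        unfolding M_def st(3)[symmetric] residue_def using T(1) by (auto intro: generate.incl)
      have finM: "finite M" using Mr residue_carrier fin by (meson finite_subset)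
      have "M \<subseteq> thin"
      proof (rule ccontr)
        assume "\<not> M \<subseteq> thin"
        then obtain m where m: "m \<in> M" "m \<notin> thin" by blast
        then have mc: "m \<in> carrier H" "m \<in> residue" using Mr residue_carrier by auto
        have B: "m <# thin \<in> P" by (rule small_thin_cosets_basic[OF thin mc(2) m(2)])
        have "m \<in> m <# thin" using subgroup.one_closed[OF thin_subgroup] mc by (force simp: l_coset_def)
        then have "m <# thin \<subseteq> M" using A_set_subset[OF MA B] m by blast
        then have "m <# thin = M"
          using finM st(1) thin card_l_coset[OF thc mc(1)] by (intro card_subset_eq) (simp_all add: M_def)
        then have "\<one> \<in> m <# thin" using subgroup.one_closed[OF Ms] by simp
        then obtain h where h: "h \<in> thin" "m \<otimes> h = \<one>" by (auto simp: l_coset_def)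
        then have "inv h = m" using mc thc by (intro inv_equality) auto
        then show False using m h subgroup.m_inv_closed[OF thin_subgroup] by blast
      qed
      then show ?thesis
        using st(1) thin thin_subset_residue residue_carrier fin
        by (intro card_subset_eq) (auto simp: M_def intro: finite_subset)
    qed
    obtain S where S: "S \<in> P" "\<not> S \<subseteq> residue" "right_stab H S \<noteq> {\<one>}"
      using two_stabs by metis
    obtain t where t: "t \<in> S" using basic_nonempty[OF S(1)] by blast
    then have tc: "t \<in> carrier H" using basic_carrier[OF S(1)] by blast
    have tr: "t \<notin> residue" using outside_disjoint[OF S(1,2) t] .
    have S_eq: "S = t <# thin" using nontrivial_stab_coset(2)[OF S(1,2) t S(3)] stab_thin[OF S] by simp
    let ?S = "set_inv S"
    have S': "?S \<in> P" "inv t \<in> ?S" using inv_basic[OF S(1)] mem_set_inv[OF t] by auto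
    have itr: "inv t \<notin> residue"
      using tr tc subgroup.m_inv_closed[OF residue_subgroup, of "inv t"] by auto
    have S'out: "\<not> ?S \<subseteq> residue" using S' itr by blast
    have S'eq: "?S = thin #> inv t"
    proof -
      have "?S = (\<Union>h\<in>thin. {inv h \<otimes> inv t})"
        unfolding S_eq using tc thc by (auto simp: SET_INV_def l_coset_def inv_mult_group subset_iff)
      also have "\<dots> = thin #> inv t"
      proof
        show "(\<Union>h\<in>thin. {inv h \<otimes> inv t}) \<subseteq> thin #> inv t"
          using subgroup.m_inv_closed[OF thin_subgroup] by (auto simp: r_coset_def)
        show "thin #> inv t \<subseteq> (\<Union>h\<in>thin. {inv h \<otimes> inv t})"
        proof
          fix y assume "y \<in> thin #> inv t"
          then obtain h where h: "h \<in> thin" "y = h \<otimes> inv t" by (auto simp: r_coset_def)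
          then have "y = inv (inv h) \<otimes> inv t" "inv h \<in> thin"
            using thc subgroup.m_inv_closed[OF thin_subgroup] by auto
          then show "y \<in> (\<Union>h\<in>thin. {inv h \<otimes> inv t})" by blast
        qed
      qed
      finally show ?thesis .
    qed
    have "right_stab H ?S \<noteq> {\<one>}"
    proof -
      have "thin \<noteq> {\<one>}" using thin p_gt_1 by auto
      then obtain k where k: "k \<in> thin" "k \<noteq> \<one>"
        using subgroup.one_closed[OF thin_subgroup] by blast
      have kc: "k \<in> carrier H" using k thc by blast
      \<comment> \<open>The conjugate of \<open>k\<close> by \<open>t\<close> stabilizes \<open>K t\<inverse>\<close> for every \<open>k \<in> K\<close>.\<close>
      have "?S #> (t \<otimes> k \<otimes> inv t) = thin #> (inv t \<otimes> (t \<otimes> k \<otimes> inv t))"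
        unfolding S'eq using thc tc kc by (simp add: coset_mult_assoc)
      also have "inv t \<otimes> (t \<otimes> k \<otimes> inv t) = k \<otimes> inv t"
        using tc kc by (simp add: m_assoc cancel_inv_left)
      also have "thin #> (k \<otimes> inv t) = thin #> k #> inv t"
        using thc tc kc by (simp add: coset_mult_assoc)
      also have "thin #> k = thin" using coset_join2[OF kc thin_subgroup k(1)] .
      finally have "t \<otimes> k \<otimes> inv t \<in> right_stab H ?S"
        using tc kc by (simp add: right_stab_def S'eq)
      moreover have "t \<otimes> k \<otimes> inv t \<noteq> \<one>"
      proof
        assume "t \<otimes> k \<otimes> inv t = \<one>"
        then have "inv t \<otimes> (t \<otimes> k \<otimes> inv t) \<otimes> t = inv t \<otimes> \<one> \<otimes> t" by simp
        then have "k = \<one>" using tc kc by (simp add: m_assoc cancel_inv_left)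
        with k show False by blast
      qed
      ultimately show ?thesis by blast
    qed
    then have "?S = inv t <# thin"
      using nontrivial_stab_coset(2)[OF S'(1) S'out S'(2)] stab_thin[OF S'(1) S'out] by simp
    then have comm: "inv t <# thin = thin #> inv t" "A_set (inv t <# thin)"
      using S'eq A_set_basic[OF S'(1)] by simp_all
    have "x <# thin = thin #> x \<and> A_set (x <# thin)" if "x \<in> insert (inv t) residue" for x
      using that comm cosets residue_coset_commute[OF thin_subset_residue] by blast
    then show False
      by (rule no_propagating_subgroup[OF thin_subgroup thin _ _ itr]) (use tc in simp_all)
  qed
  ultimately have "i = 2" using i by linarith
  then show ?thesis
    using i card_residue thin_subset_residue finite_subset[OF residue_carrier fin]
    by (intro card_subset_eq) auto
qed

section \<open>Central translates of the outer basic sets\<close>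

text \<open>
  Two elements \<open>t, u\<close> of \<open>T\<close> differ by an element \<open>l = t\<inverse> u\<close> of the residue, which is thin; so \<open>T l\<close> is
  a basic set, and it meets \<open>T\<close> in \<open>u\<close>.
\<close>

lemma outside_stab_nontrivial:
  assumes T: "T \<in> P" "\<not> T \<subseteq> residue"
  shows "right_stab H T \<noteq> {\<one>}"
proof -
  obtain t where t: "t \<in> T" using basic_nonempty[OF T(1)] by blast
  have "T \<noteq> {t}" using outside_size[OF T] p_gt_1 by auto
  then obtain u where u: "u \<in> T" "u \<noteq> t" using t by blast
  define l where "l = inv t \<otimes> u"
  have c: "t \<in> carrier H" "u \<in> carrier H" using t u basic_carrier[OF T(1)] by blast+
  have tl: "t \<otimes> l = u" using c by (simp add: l_def cancel_inv_left)
  have "l \<in> thin" unfolding thin_eq_residue l_def by (rule residueI[OF T(1) t u(1)])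
  then have "T #> l \<in> P" using T(1) by (rule thin_r_coset)
  moreover have "u \<in> T #> l" using t tl by (auto simp: r_coset_def)
  ultimately have "T #> l = T" using basic_unique[OF _ T(1) _ u(1)] by blast
  then have "l \<in> right_stab H T" using c by (simp add: right_stab_def l_def)
  moreover have "l \<noteq> \<one>" using tl u c by auto
  ultimately show ?thesis by blast
qed

lemma central_in_residue: "z \<in> group_center H \<Longrightarrow> z \<in> residue"
  using central_in_maximal_abelian[OF prime_p _ card_residue residue_carrier residue_commute _ nonabelian]
    order_H by (simp add: numeral_3_eq_3 numeral_2_eq_2)

lemma pow_p3: "x \<in> carrier H \<Longrightarrow> x [^] (p ^ 3) = \<one>"
  using pow_order_eq_1[of x] order_H by simp

text \<open>
  A stabilizer \<open>M\<close> of prime order that contains \<open>z \<noteq> 1\<close> lies in the center.  The cosets of \<open>M\<close> in the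
  residue are A-sets as the residue is thin, and \<open>T\<close> itself is an outer coset of \<open>M\<close>.
\<close>

lemma central_not_in_stab:
  assumes T: "T \<in> P" "\<not> T \<subseteq> residue" and z: "z \<in> group_center H" "z \<noteq> \<one>"
  shows "z \<notin> right_stab H T"
proof
  assume zM: "z \<in> right_stab H T"
  define M where "M = right_stab H T"
  have Ms: "subgroup M H" unfolding M_def by (rule subgroup_right_stab[OF basic_carrier[OF T(1)]])
  obtain t where t: "t \<in> T" using basic_nonempty[OF T(1)] by blast
  note st = nontrivial_stab_coset[OF T t outside_stab_nontrivial[OF T]]
  have tc: "t \<in> carrier H" using t basic_carrier[OF T(1)] by blast
  have C: "subgroup (group_center H) H"
    unfolding group_center_def by (rule centralizer_subgroup) simp
  have "M \<subseteq> group_center H"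
    using subgroup_prime_order_cases[OF Ms _ C] st(1) prime_p zM z by (auto simp: M_def)
  then have "x \<otimes> m = m \<otimes> x" if "x \<in> carrier H" "m \<in> M" for x m
    using that by (auto simp: group_center_def)
  then have comm: "x <# M = M #> x" if "x \<in> carrier H" for x
    using that by (auto simp: l_coset_def r_coset_def)
  have "M \<subseteq> residue"
    unfolding M_def st(3)[symmetric] residue_def using T(1) by (auto intro: generate.incl)
  then have "x <# M \<subseteq> thin" if "x \<in> residue" for x
    using that unfolding thin_eq_residue l_coset_def
    by (auto intro: subgroup.m_closed[OF residue_subgroup])
  then have inner: "A_set (x <# M)" if "x \<in> residue" for x
    using that by (intro A_set_if_subset_thin)
  have outer: "A_set (t <# M)"
    using st(2) A_set_basic[OF T(1)] by (simp add: M_def)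
  have "x <# M = M #> x \<and> A_set (x <# M)" if "x \<in> insert t residue" for x
    using that comm inner outer tc residue_carrier by blast
  with st(1)[folded M_def] show False
    by (rule no_propagating_subgroup[OF Ms _ _ tc outside_disjoint[OF T t]])
qed

lemma central_translate_stab:
  assumes "T \<subseteq> carrier H" "c \<in> group_center H"
  shows "right_stab H (T #> c) = right_stab H T"
proof -
  have c: "c \<in> carrier H" "\<And>h. h \<in> carrier H \<Longrightarrow> c \<otimes> h = h \<otimes> c"
    using assms(2) by (auto simp: group_center_def)
  have "T #> c #> h = T #> c \<longleftrightarrow> T #> h = T" if h: "h \<in> carrier H" for h
  proof -
    have swap: "T #> c #> h = T #> h #> c"
      using assms(1) c h by (simp add: coset_mult_assoc)
    have cancel: "X #> c #> inv c = X" if "X \<subseteq> carrier H" for X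
      using that c(1) by (simp add: coset_mult_assoc)
    have "T #> h = T" if "T #> h #> c = T #> c"
      using that cancel[OF r_coset_subset_G[OF assms(1) h]] cancel[OF assms(1)] by simp
    then show ?thesis using swap by auto
  qed
  then show ?thesis by (auto simp: right_stab_def)
qed

text \<open>
  The translates \<open>T\<^sub>i z\<^sup>j\<close> with \<open>i \<in> I\<close> and \<open>j < p\<close> are different basic sets: the stabilizer determines \<open>i\<close>,
  and if \<open>z\<^sup>k\<^sup>-\<^sup>j\<close> fixed \<open>T\<^sub>i\<close> with \<open>k - j\<close> prime to the order of \<open>H\<close>, then so would \<open>z\<close>.  Their sizes add
  up to \<open>(p - 1) p\<^sup>2 = p\<^sup>3 - p\<^sup>2\<close>, the size of the complement of the residue.
\<close>

lemma basic_sets_eq: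
  assumes z: "z \<in> group_center H" "z \<noteq> \<one>"
    and T: "\<And>i. i \<in> I \<Longrightarrow> T i \<in> P \<and> \<not> T i \<subseteq> residue"
    and I: "finite I" "card I = p - 1"
    and distinct: "inj_on (\<lambda>i. right_stab H (T i)) I"
  shows "P = {{l} | l. l \<in> residue} \<union>
    (\<Union>i\<in>I. {T i #> (z [^] j) | j::nat. 0 \<le> j \<and> j \<le> p - 1})" (is "P = ?R")
proof -
  have zr: "z \<in> residue" by (rule central_in_residue[OF z(1)])
  then have zc: "z \<in> carrier H" using residue_carrier by blast
  have C: "subgroup (group_center H) H"
    unfolding group_center_def by (rule centralizer_subgroup) simp
  have zj: "z [^] (j::nat) \<in> residue" "z [^] j \<in> group_center H" for j
    by (induction j) (auto intro: z zr subgroup.m_closed[OF residue_subgroup] subgroup.m_closed[OF C]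
        subgroup.one_closed[OF residue_subgroup] subgroup.one_closed[OF C])
  have translate: "T i #> z [^] (j::nat) \<in> P" if "i \<in> I" for i j
    using thin_r_coset T[OF that] zj by (simp add: thin_eq_residue)
  have translate_out: "T i #> z [^] (j::nat) \<subseteq> carrier H - residue" if i: "i \<in> I" for i j
  proof
    fix y assume "y \<in> T i #> z [^] j"
    then obtain t where t: "t \<in> T i" "y = t \<otimes> z [^] j" by (auto simp: r_coset_def)
    have tc: "t \<in> carrier H" using t T[OF i] basic_carrier by blast
    have "y \<notin> residue"
    proof
      assume "y \<in> residue"
      then have "y \<otimes> inv (z [^] j) \<in> residue"
        using zj residue_subgroup by (simp add: subgroup.m_closed subgroup.m_inv_closed)
      then have "t \<in> residue" using t tc zc by (simp add: m_assoc)
      then show False using outside_disjoint[of "T i" t] T[OF i] t by blast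
    qed
    then show "y \<in> carrier H - residue" using t tc zc by simp
  qed
  have neq: "T i #> z [^] j \<noteq> T i #> z [^] k"
    if i: "i \<in> I" and jk: "j < k" "k < p" for i and j k :: nat
  proof
    assume eq: "T i #> z [^] j = T i #> z [^] k"
    have Tc: "T i \<subseteq> carrier H" using T[OF i] basic_carrier by blast
    have "z [^] k \<otimes> inv (z [^] j) = z [^] (k - j)"
      using jk zc by (simp add: inv_solve_right' nat_pow_mult)
    then have "T i #> z [^] (k - j) = T i"
      using coset_mult_inv2[OF eq[symmetric]] zc Tc by simp
    then have in_stab: "z [^] (k - j) \<in> right_stab H (T i)"
      using zc by (simp add: right_stab_def)
    have sub: "subgroup (right_stab H (T i)) H" by (rule subgroup_right_stab[OF Tc])
    have "\<not> p dvd k - j" using jk by (auto dest: dvd_imp_le)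
    then have "coprime (k - j) (p ^ 3)"
      using prime_p by (simp add: prime_imp_coprime coprime_commute)
    moreover have "z [^] (p ^ 3) \<in> right_stab H (T i)"
      using pow_p3[OF zc] subgroup.one_closed[OF sub] by simp
    ultimately have "z \<in> right_stab H (T i)"
      using subgroup_mem_of_coprime_pow[OF sub zc] in_stab by blast
    then show False using central_not_in_stab T[OF i] z by blast
  qed
  have inj: "inj_on (\<lambda>(i, j). T i #> z [^] j) (I \<times> {..<p})"
  proof (rule inj_onI, clarsimp)
    fix i j i' j' assume *: "i \<in> I" "j < p" "i' \<in> I" "j' < p"
      "T i #> z [^] j = T i' #> z [^] (j' :: nat)"
    have "right_stab H (T i) = right_stab H (T i #> z [^] j)"
      using central_translate_stab T[OF *(1)] basic_carrier zj by simp
    also have "\<dots> = right_stab H (T i')"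
      unfolding *(5) using central_translate_stab T[OF *(3)] basic_carrier zj by simp
    finally have "i = i'" using distinct * by (auto dest: inj_onD)
    moreover from this have "j = j'"
      using neq[OF *(1), of j j'] neq[OF *(1), of j' j] * by (metis linorder_neqE_nat)
    ultimately show "i = i' \<and> j = j'" by simp
  qed
  define F where "F = (\<lambda>(i, j). T i #> z [^] j) ` (I \<times> {..<p})"
  have F_P: "F \<subseteq> P" using translate by (auto simp: F_def)
  have card_F: "card X = p" if "X \<in> F" for X
  proof -
    obtain i j where ij: "i \<in> I" "X = T i #> z [^] (j::nat)" using \<open>X \<in> F\<close> by (auto simp: F_def)
    have "card X = card (T i)"
      using ij T[OF ij(1)] basic_carrier zc by (simp add: card_r_coset)
    then show ?thesis using outside_size T[OF ij(1)] by simp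
  qed
  have "card (\<Union>F) = (\<Sum>X\<in>F. card X)"
  proof (rule card_Union_disjoint)
    show "disjoint F"
      using F_P partition by (auto simp: partition_on_def intro: pairwise_subset)
    show "finite X" if "X \<in> F" for X using that F_P basic_finite by blast
  qed
  also have "\<dots> = card F * p" using card_F by simp
  also have "card F = (p - 1) * p"
    unfolding F_def using card_image[OF inj] I by (simp add: card_cartesian_product)
  finally have "card (\<Union>F) = (p - 1) * p * p" .
  also have "\<dots> = p ^ 3 - p\<^sup>2"
    by (simp add: power3_eq_cube power2_eq_square diff_mult_distrib)
  also have "\<dots> = card (carrier H - residue)"
    using order_H card_residue residue_carrier fin
    by (simp add: card_Diff_subset finite_subset order_def)
  finally have "\<Union>F = carrier H - residue"
    using translate_out fin by (intro card_subset_eq) (auto simp: F_def)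
  then have cover: "X \<in> F" if X: "X \<in> P" "\<not> X \<subseteq> residue" for X
  proof -
    obtain x where "x \<in> X" using basic_nonempty[OF X(1)] by blast
    moreover then have "x \<in> \<Union>F"
      unfolding \<open>\<Union>F = carrier H - residue\<close>
      using outside_disjoint[OF X] basic_carrier[OF X(1)] by blast
    ultimately show "X \<in> F" using F_P basic_unique[OF X(1)] by blast
  qed
  show ?thesis
  proof
    show "P \<subseteq> ?R"
    proof
      fix X assume X: "X \<in> P"
      show "X \<in> ?R"
      proof (cases "X \<subseteq> residue")
        case True
        obtain x where x: "x \<in> X" using basic_nonempty[OF X] by blast
        then have "x \<in> thin" using True thin_eq_residue by blast
        then have "X = {x}" using basic_unique[OF X _ x] by (auto simp: thin_def)
        then show ?thesis using x True by blast
      next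
        case False
        then obtain i j where "i \<in> I" "j < p" "X = T i #> z [^] j"
          using cover[OF X] by (auto simp: F_def)
        then show ?thesis by (intro UnI2 UN_I[of i]) auto
      qed
    qed
    show "?R \<subseteq> P"
      using translate thin_eq_residue by (auto simp: thin_def)
  qed
qed

end

theorem lemma3p3:
  fixes p :: nat
    and H :: "('a, 'm) monoid_scheme"
    and A :: "('a \<Rightarrow> rat) set"
    and L :: "'a set"
    and z :: 'a
    and T :: "nat \<Rightarrow> 'a set"
  assumes "prime p" and "odd p"
    and "group H" and "H \<cong> H1 p \<or> H \<cong> H2 p"
    and "p_S_ring p H A" and "noncommutative_algebra H A"
    and "L = O_theta H A"
    and "\<forall>S \<in> Bsets H A - Bsets_in H A L. card S = p"
    and "card (right_stab H ` (Bsets H A - Bsets_in H A L)) = p - 1"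
    and "z \<in> group_center H" and "z \<noteq> \<one>\<^bsub>H\<^esub>"
    and "\<forall>i \<in> {1..p - 1}. T i \<in> Bsets H A - Bsets_in H A L"
    and "\<forall>i \<in> {1..p - 1}. \<forall>j \<in> {1..p - 1}.
           i \<noteq> j \<longrightarrow> right_stab H (T i) \<noteq> right_stab H (T j)"
  shows "Bsets H A =
    {{l} | l. l \<in> L} \<union>
    (\<Union>i \<in> {1..p - 1}. {T i #>\<^bsub>H\<^esub> (z [^]\<^bsub>H\<^esub> j) | j::nat. 0 \<le> j \<and> j \<le> p - 1})"
proof -
  interpret group H by fact
  have p_pos: "0 < p" using \<open>prime p\<close> by (rule prime_gt_0_nat)
  have p2: "2 \<le> p - 1"
    using prime_ge_2_nat[OF \<open>prime p\<close>] \<open>odd p\<close> by (cases "p = 2") auto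
  have nonab: "\<exists>x\<in>carrier H. \<exists>y\<in>carrier H. x \<otimes>\<^bsub>H\<^esub> y \<noteq> y \<otimes>\<^bsub>H\<^esub> x"
    using \<open>noncommutative_algebra H A\<close> conv_commute unfolding noncommutative_algebra_def by blast
  have fin: "finite (carrier H)" and dvd: "order H dvd p ^ 3"
  proof -
    have "finite (carrier H) \<and> order H dvd p ^ 3"
      using assms(4) card_H1[OF p_pos] card_H2[OF p_pos] iso_finite_card[of H "H1 p"]
        iso_finite_card[of H "H2 p"] by (auto simp: order_def)
    then show "finite (carrier H)" "order H dvd p ^ 3"
      by simp_all
  qed
  obtain i where i: "i \<le> 3" "order H = p ^ i"
    using dvd divides_primepow_nat[OF \<open>prime p\<close>] by blast
  \<comment> \<open>The presentations bound the order from above; the lower bound comes from non-commutativity.\<close>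
  have "\<not> i \<le> 2"
    using order_dvd_prime_square_imp_comm[OF \<open>prime p\<close> fin] nonab i
    by (auto dest: le_imp_power_dvd[of i 2 p])
  then have order_H: "order H = p ^ 3" using i by (simp add: le_Suc_eq numeral_3_eq_3)
  obtain P where P: "basic_partition H A P" and sizes: "\<forall>X\<in>Bsets H A. \<exists>k. card X = p ^ k"
    and alg: "group_subalgebra H A"
    using \<open>p_S_ring p H A\<close> by (auto simp: p_S_ring_def S_ring_def)
  have BP: "Bsets H A = P" by (rule Bsets_eq[OF P])
  interpret schur_partition H A P
    by unfold_locales (fact fin alg P)+
  have L: "L = residue"
    using \<open>L = O_theta H A\<close> by (simp add: O_theta_def residue_def BP)
  have outside: "X \<in> Bsets H A - Bsets_in H A L \<longleftrightarrow> X \<in> P \<and> \<not> X \<subseteq> residue" for X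
    by (auto simp: Bsets_in_def BP L)
  have two: "\<exists>S\<in>P. \<exists>S'\<in>P. \<not> S \<subseteq> residue \<and> \<not> S' \<subseteq> residue \<and> right_stab H S \<noteq> right_stab H S'"
  proof (intro bexI conjI)
    have "1 \<in> {1..p - 1}" "2 \<in> {1..p - 1}" using p2 by auto
    then show "right_stab H (T 1) \<noteq> right_stab H (T 2)"
      and "T 1 \<in> P" "T 2 \<in> P" "\<not> T 1 \<subseteq> residue" "\<not> T 2 \<subseteq> residue"
      using assms(12,13) outside by auto
  qed
  interpret thin_residue_setting H A P p
  proof
    show "prime p" "order H = p ^ 3" by fact+
    show "\<exists>x\<in>carrier H. \<exists>y\<in>carrier H. x \<otimes>\<^bsub>H\<^esub> y \<noteq> y \<otimes>\<^bsub>H\<^esub> x" by fact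
    show "\<exists>k. card X = p ^ k" if "X \<in> P" for X using sizes that BP by blast
    show "card X = p" if "X \<in> P" "\<not> X \<subseteq> residue" for X using assms(8) outside that by blast
  qed (fact two)
  show ?thesis
    unfolding BP L
  proof (rule basic_sets_eq)
    show "inj_on (\<lambda>i. right_stab H (T i)) {1..p - 1}"
      using assms(13) by (auto intro!: inj_onI)
  qed (use assms(10-12) outside in auto)
qed

end
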